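(* Let $S$ be a density operator on $L^2(\mathbb{R}^d)$ and let $\Omega\subset\mathbb{R}^{2d}$ be a compact set. Then $$\chi_\Omega*\tilde S(z)=\sum_{k=1}^\infty\lambda_k^\Omega\,Q_S(h_k^\Omega)(z)\quad\text{for } z\in\mathbb{R}^{2d},$$ where $*$ is the usual convolution of functions on $\mathbb{R}^{2d}$.
   Context: Fix $d\ge 1$. For $z=(x,\omega)\in\mathbb{R}^{2d}$ let $\pi(z)\psi(t)=e^{2\pi i\omega\cdot t}\psi(t-x)$ on $L^2(\mathbb{R}^d)$. For a bounded operator $A$ on $L^2(\mathbb{R}^d)$ let $\alpha_z(A)=\pi(z)A\pi(z)^*$ and $\check A=PAP$, where $P\psi(x)=\psi(-x)$. For $f\in L^1(\mathbb{R}^{2d})$ and a trace class operator $S$, $f\star S=\int_{\mathbb{R}^{2d}}f(z)\alpha_z(S)\,dz$ (weakly defined; a trace class operator). For trace class operators $S,T$, $S\star T$ is the function $S\star T(z)=\mathrm{tr}(S\,\alpha_z(\check T))$ on $\mathbb{R}^{2d}$. The rank-one operator $\psi\otimes\varphi$ is $\xi\mapsto\langle\xi,\varphi\rangle\psi$. A density operator is a positive trace class operator $S$ with $\mathrm{tr}(S)=1$. Write $\tilde S=S\star\check S$ and, for $\psi\in L^2(\mathbb{R}^d)$, $Q_S(\psi)=\check S\star(\psi\otimes\psi)$. $\chi_\Omega$ is the characteristic function of $\Omega$. The operator $\chi_\Omega\star S$ is a positive trace class operator; $\{\lambda_k^\Omega\}_{k\in\mathbb{N}}$ denotes its eigenvalues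 (counted with multiplicity), arranged in decreasing order $\lambda_1^\Omega\ge\lambda_2^\Omega\ge\cdots$, and $\{h_k^\Omega\}_{k\in\mathbb{N}}$ denotes the orthonormal basis of $L^2(\mathbb{R}^d)$ formed by its eigenfunctions, so that the spectral representation is $\chi_\Omega\star S=\sum_{k=1}^\infty\lambda_k^\Omega\, h_k^\Omega\otimes h_k^\Omega$. *)

theory Defs
  imports "HOL-Analysis.Analysis"
begin

section \<open>The Hilbert space of square integrable functions\<close>

definition sq_integrable :: "('a::euclidean_space \<Rightarrow> complex) \<Rightarrow> bool" where
  "sq_integrable f \<longleftrightarrow> f \<in> borel_measurable lborel \<and> integrable lborel (\<lambda>x. (cmod (f x))\<^sup>2)"

definition l2rel :: "('a::euclidean_space \<Rightarrow> complex) \<Rightarrow> ('a \<Rightarrow> complex) \<Rightarrow> bool" where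
  "l2rel f g \<longleftrightarrow> sq_integrable f \<and> sq_integrable g \<and> (AE x in lborel. f x = g x)"

lemma sq_integrable_zero [simp]: "sq_integrable (\<lambda>_. 0)"
  by (simp add: sq_integrable_def)

lemma sq_integrable_measurable: "sq_integrable f \<Longrightarrow> f \<in> borel_measurable borel"
  by (simp add: sq_integrable_def)

lemma sq_integrable_add:
  assumes "sq_integrable f" "sq_integrable g"
  shows "sq_integrable (\<lambda>x. f x + g x)"
proof -
  have m: "f \<in> borel_measurable borel" "g \<in> borel_measurable borel"
    using assms by (auto dest: sq_integrable_measurable)
  have i: "integrable lborel (\<lambda>x. 2 * (cmod (f x))\<^sup>2 + 2 * (cmod (g x))\<^sup>2)"
    using assms by (auto simp: sq_integrable_def)
  have "(cmod (f x + g x))\<^sup>2 \<le> 2 * (cmod (f x))\<^sup>2 + 2 * (cmod (g x))\<^sup>2" for x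
  proof -
    have "(cmod (f x + g x))\<^sup>2 \<le> (cmod (f x) + cmod (g x))\<^sup>2"
      by (intro power_mono norm_triangle_ineq) simp
    also have "\<dots> \<le> 2 * (cmod (f x))\<^sup>2 + 2 * (cmod (g x))\<^sup>2"
      using sum_squares_bound[of "cmod (f x)" "cmod (g x)"] by (simp add: power2_sum)
    finally show ?thesis .
  qed
  then have "integrable lborel (\<lambda>x. (cmod (f x + g x))\<^sup>2)"
    using m by (intro Bochner_Integration.integrable_bound[OF i]) auto
  with m show ?thesis by (simp add: sq_integrable_def)
qed

lemma sq_integrable_cmult:
  assumes "sq_integrable f"
  shows "sq_integrable (\<lambda>x. c * f x)"
  using assms by (auto simp: sq_integrable_def norm_mult power_mult_distrib)

lemma sq_integrable_uminus: "sq_integrable f \<Longrightarrow> sq_integrable (\<lambda>x. - f x)"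
  using sq_integrable_cmult[of f "-1"] by simp

lemma sq_integrable_diff:
  "sq_integrable f \<Longrightarrow> sq_integrable g \<Longrightarrow> sq_integrable (\<lambda>x. f x - g x)"
  using sq_integrable_add[of f "\<lambda>x. - g x"] by (simp add: sq_integrable_uminus)

lemma borel_measurable_cnj [measurable]:
  "f \<in> borel_measurable M \<Longrightarrow> (\<lambda>x. cnj (f x)) \<in> borel_measurable M"
  by (rule borel_measurable_continuous_on[of cnj]) (auto intro: continuous_intros)

lemma integrable_mult_cnj:
  assumes "sq_integrable f" "sq_integrable g"
  shows "integrable lborel (\<lambda>x. f x * cnj (g x))"
proof -
  have m [measurable]: "f \<in> borel_measurable borel" "g \<in> borel_measurable borel"
    using assms by (auto dest: sq_integrable_measurable)
  have i: "integrable lborel (\<lambda>x. (cmod (f x))\<^sup>2 + (cmod (g x))\<^sup>2)"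
    using assms by (auto simp: sq_integrable_def)
  have "cmod (f x * cnj (g x)) \<le> (cmod (f x))\<^sup>2 + (cmod (g x))\<^sup>2" for x
    using sum_squares_bound[of "cmod (f x)" "cmod (g x)"]
      mult_nonneg_nonneg[OF norm_ge_zero[of "f x"] norm_ge_zero[of "g x"]]
    unfolding norm_mult complex_mod_cnj by linarith
  moreover have "(\<lambda>x. f x * cnj (g x)) \<in> borel_measurable lborel"
    by measurable
  ultimately show ?thesis
    by (intro Bochner_Integration.integrable_bound[OF i]) (auto intro!: AE_I2 order_trans[OF _ abs_ge_self])
qed

lemma lborel_distr_translate:
  fixes a :: "'a::euclidean_space"
  shows "distr lborel borel (\<lambda>t. t - a) = lborel"
  by (subst (2) lborel_affine[of 1 "- a"]) (simp_all add: density_1)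

lemma lborel_distr_reflect:
  "distr lborel borel (\<lambda>t::'a::euclidean_space. - t) = lborel"
  by (subst (2) lborel_affine[of "-1" "0::'a"]) (simp_all add: density_1)

lemma l2rel_comp:
  fixes T :: "'a::euclidean_space \<Rightarrow> 'a"
  assumes T [measurable]: "T \<in> borel_measurable borel"
    and d: "distr lborel borel T = lborel"
    and r: "l2rel f g"
  shows "l2rel (\<lambda>t. f (T t)) (\<lambda>t. g (T t))"
proof -
  have Tm: "T \<in> measurable lborel borel" by simp
  have sq: "sq_integrable (\<lambda>t. u (T t))" if u: "sq_integrable u" for u :: "'a \<Rightarrow> complex"
  proof -
    have [measurable]: "u \<in> borel_measurable borel"
      using u by (rule sq_integrable_measurable)
    have "integrable (distr lborel borel T) (\<lambda>x. (cmod (u x))\<^sup>2)"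
      using u by (simp add: d sq_integrable_def)
    then have "integrable lborel (\<lambda>x. (cmod (u (T x)))\<^sup>2)"
      by (rule integrable_distr[OF Tm])
    then show ?thesis by (simp add: sq_integrable_def)
  qed
  have "AE x in distr lborel borel T. f x = g x"
    using r unfolding d by (simp add: l2rel_def)
  moreover have [measurable]: "f \<in> borel_measurable borel" "g \<in> borel_measurable borel"
    using r by (auto simp: l2rel_def dest: sq_integrable_measurable)
  ultimately have "AE x in lborel. f (T x) = g (T x)"
    by (subst (asm) AE_distr_iff) auto
  then show ?thesis using r sq by (simp add: l2rel_def)
qed

quotient_type (overloaded) 'a l2 = "'a::euclidean_space \<Rightarrow> complex" / partial: l2rel
proof (rule part_equivpI)
  show "\<exists>f :: 'a \<Rightarrow> complex. l2rel f f"
    by (rule exI[of _ "\<lambda>_. 0"]) (simp add: l2rel_def)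
  show "symp (l2rel :: ('a \<Rightarrow> complex) \<Rightarrow> _)"
    by (auto simp: symp_def l2rel_def)
  show "transp (l2rel :: ('a \<Rightarrow> complex) \<Rightarrow> _)"
    by (auto simp: transp_def l2rel_def)
qed

lift_definition cinner :: "'a::euclidean_space l2 \<Rightarrow> 'a l2 \<Rightarrow> complex"
  is "\<lambda>f g. LINT x|lborel. f x * cnj (g x)"
proof -
  fix f1 f2 g1 g2 :: "'a \<Rightarrow> complex"
  assume r: "l2rel f1 f2" "l2rel g1 g2"
  then have [measurable]: "f1 \<in> borel_measurable borel" "f2 \<in> borel_measurable borel"
      "g1 \<in> borel_measurable borel" "g2 \<in> borel_measurable borel"
    by (auto simp: l2rel_def dest: sq_integrable_measurable)
  have "AE x in lborel. f1 x = f2 x" "AE x in lborel. g1 x = g2 x"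
    using r by (auto simp: l2rel_def)
  then have "AE x in lborel. f1 x * cnj (g1 x) = f2 x * cnj (g2 x)"
    by eventually_elim simp
  then show "(LINT x|lborel. f1 x * cnj (g1 x)) = (LINT x|lborel. f2 x * cnj (g2 x))"
    by (intro integral_cong_AE) auto
qed

lift_definition scaleC :: "complex \<Rightarrow> 'a::euclidean_space l2 \<Rightarrow> 'a l2"  (infixr "*\<^sub>C" 75)
  is "\<lambda>c f x. c * f x"
  by (auto simp: l2rel_def sq_integrable_cmult)

instantiation l2 :: (euclidean_space) real_vector
begin

lift_definition zero_l2 :: "'a l2" is "\<lambda>_. 0"
  by (simp add: l2rel_def)

lift_definition plus_l2 :: "'a l2 \<Rightarrow> 'a l2 \<Rightarrow> 'a l2" is "\<lambda>f g x. f x + g x"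
  by (auto simp: l2rel_def sq_integrable_add)

lift_definition minus_l2 :: "'a l2 \<Rightarrow> 'a l2 \<Rightarrow> 'a l2" is "\<lambda>f g x. f x - g x"
  by (auto simp: l2rel_def sq_integrable_diff)

lift_definition uminus_l2 :: "'a l2 \<Rightarrow> 'a l2" is "\<lambda>f x. - f x"
  by (auto simp: l2rel_def sq_integrable_uminus)

definition scaleR_l2 :: "real \<Rightarrow> 'a l2 \<Rightarrow> 'a l2" where
  "scaleR_l2 r f = complex_of_real r *\<^sub>C f"

instance
proof
  fix a b c :: "'a l2" and r s :: real
  show "a + b + c = a + (b + c)"
    by transfer (auto simp: l2rel_def sq_integrable_add add.assoc)
  show "a + b = b + a"
    by transfer (auto simp: l2rel_def sq_integrable_add add.commute)
  show "0 + a = a"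
    by transfer (auto simp: l2rel_def)
  show "- a + a = 0"
    by transfer (auto simp: l2rel_def)
  show "a - b = a + - b"
    by transfer (auto simp: l2rel_def sq_integrable_diff)
  show "r *\<^sub>R (a + b) = r *\<^sub>R a + r *\<^sub>R b"
    unfolding scaleR_l2_def
    by transfer (auto simp: l2rel_def distrib_left intro!: sq_integrable_add sq_integrable_cmult)
  show "(r + s) *\<^sub>R a = r *\<^sub>R a + s *\<^sub>R a"
    unfolding scaleR_l2_def
    by transfer (auto simp: l2rel_def distrib_right intro!: sq_integrable_add sq_integrable_cmult)
  show "r *\<^sub>R s *\<^sub>R a = (r * s) *\<^sub>R a"
    unfolding scaleR_l2_def
    by transfer (auto simp: l2rel_def mult.assoc intro!: sq_integrable_cmult)
  show "1 *\<^sub>R a = a"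
    unfolding scaleR_l2_def by transfer (auto simp: l2rel_def)
qed

end

lemma cinner_commute: "cinner x y = cnj (cinner y x)"
proof transfer
  fix f g :: "'a \<Rightarrow> complex"
  show "(LINT x|lborel. f x * cnj (g x)) = cnj (LINT x|lborel. g x * cnj (f x))"
    by (simp add: Bochner_Integration.integral_cnj[symmetric] mult.commute del: Bochner_Integration.integral_cnj)
qed

lemma cinner_add_left: "cinner (x + y) z = cinner x z + cinner y z"
  by transfer (auto simp: l2rel_def distrib_right integrable_mult_cnj)

lemma cinner_scaleC_left: "cinner (c *\<^sub>C x) y = c * cinner x y"
  by transfer (simp add: mult.assoc)

lemma cinner_self: "Im (cinner x x) = 0" "0 \<le> Re (cinner x x)"
proof -
  have "cinner x x \<in> \<real> \<and> 0 \<le> Re (cinner x x)"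
  proof transfer
    fix f :: "'a \<Rightarrow> complex"
    have "(LINT x|lborel. f x * cnj (f x)) = complex_of_real (LINT x|lborel. (cmod (f x))\<^sup>2)"
      by (subst integral_complex_of_real[symmetric]) (simp only: complex_norm_square)
    then show "(LINT x|lborel. f x * cnj (f x)) \<in> \<real> \<and> 0 \<le> Re (LINT x|lborel. f x * cnj (f x))"
      by simp
  qed
  then show "Im (cinner x x) = 0" "0 \<le> Re (cinner x x)"
    by (auto simp: complex_is_Real_iff)
qed

lemma cinner_self_eq_zero: "cinner x x = 0 \<longleftrightarrow> x = 0"
proof transfer
  fix f :: "'a \<Rightarrow> complex"
  assume "l2rel f f"
  then have f: "sq_integrable f" by (simp add: l2rel_def)
  have "(LINT x|lborel. f x * cnj (f x)) = complex_of_real (LINT x|lborel. (cmod (f x))\<^sup>2)"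
    by (subst integral_complex_of_real[symmetric]) (simp only: complex_norm_square)
  moreover have "(LINT x|lborel. (cmod (f x))\<^sup>2) = 0 \<longleftrightarrow> (AE x in lborel. (cmod (f x))\<^sup>2 = 0)"
    using f by (intro integral_nonneg_eq_0_iff_AE) (auto simp: sq_integrable_def)
  ultimately show "(LINT x|lborel. f x * cnj (f x)) = 0 \<longleftrightarrow> l2rel f (\<lambda>_. 0)"
    using f by (simp add: l2rel_def)
qed

instantiation l2 :: (euclidean_space) real_inner
begin

definition inner_l2 :: "'a l2 \<Rightarrow> 'a l2 \<Rightarrow> real" where
  "inner_l2 x y = Re (cinner x y)"

definition norm_l2 :: "'a l2 \<Rightarrow> real" where
  "norm_l2 x = sqrt (inner x x)"

definition dist_l2 :: "'a l2 \<Rightarrow> 'a l2 \<Rightarrow> real" where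
  "dist_l2 x y = norm (x - y)"

definition sgn_l2 :: "'a l2 \<Rightarrow> 'a l2" where
  "sgn_l2 x = x /\<^sub>R norm x"

definition uniformity_l2 :: "('a l2 \<times> 'a l2) filter" where
  "uniformity_l2 = (INF e\<in>{0 <..}. principal {(x, y). dist x y < e})"

definition open_l2 :: "'a l2 set \<Rightarrow> bool" where
  "open_l2 U \<longleftrightarrow> (\<forall>x\<in>U. \<forall>\<^sub>F (x', y) in uniformity. x' = x \<longrightarrow> y \<in> U)"

instance
proof
  fix x y z :: "'a l2" and r :: real and U :: "'a l2 set"
  show "dist x y = norm (x - y)" by (rule dist_l2_def)
  show "sgn x = x /\<^sub>R norm x" by (rule sgn_l2_def)
  show "uniformity = (INF e\<in>{0 <..}. principal {(x, y :: 'a l2). dist x y < e})"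
    by (rule uniformity_l2_def)
  show "open U \<longleftrightarrow> (\<forall>x\<in>U. \<forall>\<^sub>F (x', y) in uniformity. x' = x \<longrightarrow> y \<in> U)"
    by (rule open_l2_def)
  show "inner x y = inner y x"
    unfolding inner_l2_def by (subst cinner_commute) simp
  show "inner (x + y) z = inner x z + inner y z"
    by (simp add: inner_l2_def cinner_add_left)
  show "inner (r *\<^sub>R x) y = r * inner x y"
    by (simp add: inner_l2_def scaleR_l2_def cinner_scaleC_left)
  show "0 \<le> inner x x"
    by (simp add: inner_l2_def cinner_self)
  show "inner x x = 0 \<longleftrightarrow> x = 0"
    using cinner_self(1)[of x] cinner_self_eq_zero[of x] by (auto simp: inner_l2_def complex_eq_iff)
  show "norm x = sqrt (inner x x)" by (rule norm_l2_def)
qed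

end

section \<open>Operators\<close>

definition bounded_clinear :: "('a::euclidean_space l2 \<Rightarrow> 'a l2) \<Rightarrow> bool" where
  "bounded_clinear A \<longleftrightarrow> bounded_linear A \<and> (\<forall>c x. A (c *\<^sub>C x) = c *\<^sub>C A x)"

definition adjoint_op :: "('a::euclidean_space l2 \<Rightarrow> 'a l2) \<Rightarrow> ('a l2 \<Rightarrow> 'a l2)" where
  "adjoint_op A = (THE B. \<forall>x y. cinner (A x) y = cinner x (B y))"

definition positive_op :: "('a::euclidean_space l2 \<Rightarrow> 'a l2) \<Rightarrow> bool" where
  "positive_op A \<longleftrightarrow> (\<forall>x. cinner (A x) x \<in> \<real>\<^sub>\<ge>\<^sub>0)"

definition rank_one :: "'a::euclidean_space l2 \<Rightarrow> 'a l2 \<Rightarrow> ('a l2 \<Rightarrow> 'a l2)"  (infixl "\<otimes>\<^sub>o" 70) where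
  "\<psi> \<otimes>\<^sub>o \<phi> = (\<lambda>\<xi>. cinner \<xi> \<phi> *\<^sub>C \<psi>)"

definition orthonormal_seq :: "(nat \<Rightarrow> 'a::euclidean_space l2) \<Rightarrow> bool" where
  "orthonormal_seq e \<longleftrightarrow> (\<forall>m n. cinner (e m) (e n) = (if m = n then 1 else 0))"

text \<open>Singular value decomposition with summable singular values. Zero singular values are
  allowed, so that operators of finite rank are covered by infinite sequences as well.\<close>

definition trace_class :: "('a::euclidean_space l2 \<Rightarrow> 'a l2) \<Rightarrow> bool" where
  "trace_class A \<longleftrightarrow> bounded_clinear A \<and>
     (\<exists>s e f. (\<forall>n. 0 \<le> s n) \<and> summable s \<and> orthonormal_seq e \<and> orthonormal_seq f \<and>
        (\<forall>x. (\<lambda>n. s n *\<^sub>R (e n \<otimes>\<^sub>o f n) x) sums A x))"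

definition orthonormal_basis :: "'a::euclidean_space l2 set \<Rightarrow> bool" where
  "orthonormal_basis B \<longleftrightarrow>
     (\<forall>x\<in>B. \<forall>y\<in>B. cinner x y = (if x = y then 1 else 0)) \<and>
     (\<forall>x. (\<forall>b\<in>B. cinner x b = 0) \<longrightarrow> x = 0)"

text \<open>The value common to all orthonormal bases; the trace is only used for trace class operators,
  where it is well defined.\<close>

definition trace_op :: "('a::euclidean_space l2 \<Rightarrow> 'a l2) \<Rightarrow> complex" where
  "trace_op A =
     (THE t. \<forall>B. orthonormal_basis B \<longrightarrow> ((\<lambda>b. cinner (A b) b) has_sum t) B)"

definition density_operator :: "('a::euclidean_space l2 \<Rightarrow> 'a l2) \<Rightarrow> bool" where
  "density_operator S \<longleftrightarrow> positive_op S \<and> trace_class S \<and> trace_op S = 1"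

section \<open>Time-frequency shifts and convolutions\<close>

lift_definition tf_shift :: "'a::euclidean_space \<times> 'a \<Rightarrow> 'a l2 \<Rightarrow> 'a l2"
  is "\<lambda>(x, \<omega>) \<psi> t. exp (2 * of_real pi * \<i> * of_real (\<omega> \<bullet> t)) * \<psi> (t - x)"
proof -
  fix z :: "'a \<times> 'a" and f g :: "'a \<Rightarrow> complex"
  obtain x \<omega> where z: "z = (x, \<omega>)" by (cases z)
  assume "l2rel f g"
  then have r: "l2rel (\<lambda>t. f (t - x)) (\<lambda>t. g (t - x))"
    by (rule l2rel_comp[rotated 2]) (simp_all add: lborel_distr_translate)
  have e: "sq_integrable (\<lambda>t. exp (2 * of_real pi * \<i> * of_real (\<omega> \<bullet> t)) * u t)"
    if u: "sq_integrable u" for u :: "'a \<Rightarrow> complex"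
  proof -
    have [measurable]: "u \<in> borel_measurable borel"
      using u by (rule sq_integrable_measurable)
    have [measurable]: "(\<lambda>t. exp (2 * of_real pi * \<i> * of_real (\<omega> \<bullet> t))) \<in> borel_measurable borel"
      by (intro borel_measurable_continuous_onI continuous_intros)
    have "cmod (exp (2 * of_real pi * \<i> * of_real (\<omega> \<bullet> t)) * u t) = cmod (u t)" for t
      by (simp add: norm_mult)
    then show ?thesis using u by (simp add: sq_integrable_def)
  qed
  show "l2rel ((case z of (x, \<omega>) \<Rightarrow> \<lambda>\<psi> t. exp (2 * of_real pi * \<i> * of_real (\<omega> \<bullet> t)) * \<psi> (t - x)) f)
      ((case z of (x, \<omega>) \<Rightarrow> \<lambda>\<psi> t. exp (2 * of_real pi * \<i> * of_real (\<omega> \<bullet> t)) * \<psi> (t - x)) g)"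
    using r e by (auto simp: z l2rel_def)
qed

lift_definition parity :: "'a::euclidean_space l2 \<Rightarrow> 'a l2" is "\<lambda>\<psi> x. \<psi> (- x)"
  by (rule l2rel_comp[rotated 2]) (simp_all add: lborel_distr_reflect)

definition op_shift :: "'a::euclidean_space \<times> 'a \<Rightarrow> ('a l2 \<Rightarrow> 'a l2) \<Rightarrow> ('a l2 \<Rightarrow> 'a l2)" where
  "op_shift z A = tf_shift z \<circ> A \<circ> adjoint_op (tf_shift z)"

definition op_check :: "('a::euclidean_space l2 \<Rightarrow> 'a l2) \<Rightarrow> ('a l2 \<Rightarrow> 'a l2)" where
  "op_check A = parity \<circ> A \<circ> parity"

definition fun_conv ::
  "('a::euclidean_space \<times> 'a \<Rightarrow> complex) \<Rightarrow> ('a \<times> 'a \<Rightarrow> complex) \<Rightarrow> ('a \<times> 'a \<Rightarrow> complex)" where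
  "fun_conv f g z = (LINT w|lborel. f w * g (z - w))"

text \<open>The weak integral of \<open>f z\<close> times the shifted operator over phase space.\<close>

definition fun_op_conv ::
  "('a::euclidean_space \<times> 'a \<Rightarrow> complex) \<Rightarrow> ('a l2 \<Rightarrow> 'a l2) \<Rightarrow> ('a l2 \<Rightarrow> 'a l2)" where
  "fun_op_conv f S = (THE A. bounded_clinear A \<and>
     (\<forall>\<psi> \<phi>. cinner (A \<psi>) \<phi> = (LINT z|lborel. f z * cinner (op_shift z S \<psi>) \<phi>)))"

definition op_conv ::
  "('a::euclidean_space l2 \<Rightarrow> 'a l2) \<Rightarrow> ('a l2 \<Rightarrow> 'a l2) \<Rightarrow> ('a \<times> 'a \<Rightarrow> complex)" where
  "op_conv S T z = trace_op (S \<circ> op_shift z (op_check T))"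

definition op_tilde :: "('a::euclidean_space l2 \<Rightarrow> 'a l2) \<Rightarrow> ('a \<times> 'a \<Rightarrow> complex)" where
  "op_tilde S = op_conv S (op_check S)"

definition cohen_Q ::
  "('a::euclidean_space l2 \<Rightarrow> 'a l2) \<Rightarrow> 'a l2 \<Rightarrow> ('a \<times> 'a \<Rightarrow> complex)" where
  "cohen_Q S \<psi> = op_conv (op_check S) (\<psi> \<otimes>\<^sub>o \<psi>)"

section \<open>Eigenvalues and eigenfunctions\<close>

text \<open>A decreasing enumeration of the eigenvalues, with multiplicity, together with orthonormal
  eigenfunctions. If \<open>A\<close> has infinite rank and a nontrivial kernel, then the eigenfunctions in a
  decreasing enumeration cannot span the kernel. Hence the eigenfunctions are only required to be
  complete up to the kernel: \<open>A\<close> vanishes on their orthogonal complement. An orthonormal basis of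
  eigenfunctions is a special case (lemma \<open>eigensystem_of_basis\<close>).\<close>

definition eigensystem ::
  "('a::euclidean_space l2 \<Rightarrow> 'a l2) \<Rightarrow> (nat \<Rightarrow> real) \<Rightarrow> (nat \<Rightarrow> 'a l2) \<Rightarrow> bool" where
  "eigensystem A lam h \<longleftrightarrow> decseq lam \<and> orthonormal_seq h \<and>
     (\<forall>k. A (h k) = lam k *\<^sub>R h k) \<and>
     (\<forall>x. (\<forall>k. cinner x (h k) = 0) \<longrightarrow> A x = 0)"

lemma eigensystem_of_basis:
  assumes A: "bounded_clinear A" and "decseq lam" and "inj h" and B: "orthonormal_basis (range h)"
    and "\<And>k. A (h k) = lam k *\<^sub>R h k"
  shows "eigensystem A lam h"
proof -
  have "orthonormal_seq h"
    using B \<open>inj h\<close> by (auto simp: orthonormal_basis_def orthonormal_seq_def inj_eq)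
  moreover have "A x = 0" if "\<forall>k. cinner x (h k) = 0" for x
  proof -
    have "x = 0" using B that by (auto simp: orthonormal_basis_def)
    then show ?thesis
      using A by (simp add: bounded_clinear_def linear_0 bounded_linear.linear)
  qed
  ultimately show ?thesis using assms by (simp add: eigensystem_def)
qed

end

theory Submission
  imports Defs
begin

text \<open>
  Write \<open>\<alpha>\<^sub>w(S)\<close> for the shifted operator \<open>op_shift w S\<close>, put \<open>A = \<chi>\<^sub>\<Omega> \<star> S\<close> and \<open>T = \<alpha>\<^sub>z(S)\<close>. Both sides of the
  formula are the trace of \<open>A T\<close>, computed in two ways.

  On the left, \<open>cohen_Q S x z\<close> is the trace of an operator of rank one, and the two parity operators
  turn the shift by \<open>z\<close> into the shift by \<open>-z\<close>, which is the adjoint of the former up to a phase; the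
  outcome is \<open>\<langle>T x, x\<rangle>\<close> (lemma \<open>cohen_Q_eq\<close>). Hence the left-hand side is
  \<open>\<Sum>\<^sub>k \<lambda>\<^sub>k \<langle>T h\<^sub>k, h\<^sub>k\<rangle>\<close>, the trace of \<open>A T\<close> along the eigenfunctions of \<open>A\<close>.

  On the right, covariance of the shifts up to phases gives
  \<open>op_tilde S (z - w) = tr(\<alpha>\<^sub>w(S) T)\<close> (lemma \<open>op_tilde_diff\<close>), and integrating over \<open>w \<in> \<Omega>\<close> replaces
  \<open>\<alpha>\<^sub>w(S)\<close> by its weak integral \<open>A\<close> (lemma \<open>fun_conv_op_tilde\<close>).

  What makes both computations rigorous is a singular value expansion of \<open>S\<close>. It moves to an expansion
  \<open>T = \<Sum>\<^sub>n s\<^sub>n e\<^sub>n \<otimes> f\<^sub>n\<close> with \<open>\<Sum>\<^sub>n s\<^sub>n < \<infinity>\<close> and unit vectors, and for every bounded \<open>B\<close> the trace of \<open>B T\<close>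
  is the absolutely convergent series \<open>\<Sum>\<^sub>n s\<^sub>n \<langle>B e\<^sub>n, f\<^sub>n\<rangle>\<close> (lemma \<open>trace_op_comp_nuclear_series\<close>).
  The summable \<open>s\<^sub>n\<close> dominate every exchange of a sum with another sum or with an integral. In particular,
  inserting \<open>A x = \<Sum>\<^sub>k \<lambda>\<^sub>k \<langle>x, h\<^sub>k\<rangle> h\<^sub>k\<close> into \<open>\<Sum>\<^sub>n s\<^sub>n \<langle>A e\<^sub>n, f\<^sub>n\<rangle>\<close> and exchanging the sums gives the
  left-hand side (lemma \<open>sums_eigenvalues_nuclear_series\<close>).

  The trace and the weak integral are given by unique descriptions, so both have to be shown to exist.
  This rests on completeness of the Hilbert space (Riesz-Fischer): it yields orthonormal expansions,
  Parseval's identity for every orthonormal basis, and the operator represented by a bounded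
  sesquilinear form.
\<close>

section \<open>The complex inner product\<close>

lemma cinner_add_right: "cinner x (y + z) = cinner x y + cinner x z"
  by (metis cinner_add_left cinner_commute complex_cnj_add)

lemma cinner_scaleC_right: "cinner x (c *\<^sub>C y) = cnj c * cinner x y"
  by (metis cinner_commute cinner_scaleC_left complex_cnj_mult)

lemma cinner_scaleR_left: "cinner (r *\<^sub>R x) y = of_real r * cinner x y"
  by (simp add: scaleR_l2_def cinner_scaleC_left)

lemma cinner_diff_left: "cinner (x - y) z = cinner x z - cinner y z"
  using cinner_add_left[of "x - y" y z] by simp

lemma cinner_diff_right: "cinner x (y - z) = cinner x y - cinner x z"
  using cinner_add_right[of x "y - z" z] by simp

lemma cinner_zero_left [simp]: "cinner 0 x = 0"
  using cinner_diff_left[of 0 0 x] by simp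

lemma cinner_zero_right [simp]: "cinner x 0 = 0"
  using cinner_diff_right[of x 0 0] by simp

lemma cinner_sum_left: "cinner (\<Sum>i\<in>F. u i) y = (\<Sum>i\<in>F. cinner (u i) y)"
  by (induction F rule: infinite_finite_induct) (simp_all add: cinner_add_left)

lemma cinner_sum_right: "cinner x (\<Sum>i\<in>F. u i) = (\<Sum>i\<in>F. cinner x (u i))"
  by (induction F rule: infinite_finite_induct) (simp_all add: cinner_add_right)

lemma cinner_self_norm: "cinner x x = of_real ((norm x)\<^sup>2)"
  using cinner_self[of x] by (simp add: complex_eq_iff power2_norm_eq_inner inner_l2_def)

lemma l2_eqI: "(\<And>y. cinner x y = cinner x' y) \<Longrightarrow> x = x'"
  using cinner_self_eq_zero[of "x - x'"] by (simp add: cinner_diff_left)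

lemma l2_eqI_right: "(\<And>y. cinner y x = cinner y x') \<Longrightarrow> x = x'"
  by (rule l2_eqI) (metis cinner_commute)

lemma scaleC_scaleC: "a *\<^sub>C b *\<^sub>C x = (a * b) *\<^sub>C x"
  by (rule l2_eqI) (simp add: cinner_scaleC_left)

lemma scaleC_one [simp]: "1 *\<^sub>C x = x"
  by (rule l2_eqI) (simp add: cinner_scaleC_left)

lemma scaleC_zero_left [simp]: "0 *\<^sub>C x = 0"
  by (rule l2_eqI) (simp add: cinner_scaleC_left)

lemma scaleC_scaleR: "c *\<^sub>C r *\<^sub>R x = r *\<^sub>R c *\<^sub>C x"
  by (rule l2_eqI) (simp add: cinner_scaleC_left cinner_scaleR_left)

lemma scaleR_scaleC: "r *\<^sub>R c *\<^sub>C x = (of_real r * c) *\<^sub>C x"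
  by (rule l2_eqI) (simp add: cinner_scaleC_left cinner_scaleR_left)

lemma norm_scaleC: "norm (c *\<^sub>C x) = cmod c * norm x"
proof -
  have "complex_of_real ((norm (c *\<^sub>C x))\<^sup>2) = c * cnj c * cinner x x"
    by (simp only: cinner_self_norm[symmetric] cinner_scaleC_left cinner_scaleC_right mult_ac)
  also have "\<dots> = complex_of_real ((cmod c * norm x)\<^sup>2)"
    by (simp add: cinner_self_norm complex_norm_square[symmetric] power_mult_distrib)
  finally have "(norm (c *\<^sub>C x))\<^sup>2 = (cmod c * norm x)\<^sup>2"
    by (simp only: of_real_eq_iff)
  then show ?thesis
    by (simp add: power2_eq_iff_nonneg)
qed

text \<open>
  The real Cauchy-Schwarz inequality bounds only the real part of the inner product; multiplying one
  argument by a phase makes the inner product real without changing the norms.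
\<close>

lemma cmod_cinner_le: "cmod (cinner x y) \<le> norm x * norm y"
proof (cases "cinner x y = 0")
  case False
  define c where "c = cnj (cinner x y) / of_real (cmod (cinner x y))"
  have "cmod c = 1"
    using False by (simp add: c_def norm_divide)
  have "c * cinner x y = of_real (cmod (cinner x y))"
    using False by (simp add: c_def complex_norm_square[symmetric] mult.commute power2_eq_square)
  then have "cmod (cinner x y) = inner (c *\<^sub>C x) y"
    by (simp add: inner_l2_def cinner_scaleC_left)
  also have "\<dots> \<le> norm (c *\<^sub>C x) * norm y"
    by (rule norm_cauchy_schwarz)
  finally show ?thesis
    by (simp add: norm_scaleC \<open>cmod c = 1\<close>)
qed simp

lemma bounded_linear_cinner_left: "bounded_linear (\<lambda>x. cinner x y)"
  by (rule bounded_linear_intro[where K = "norm y"])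
    (simp_all add: cinner_add_left cinner_scaleR_left cmod_cinner_le scaleR_conv_of_real)

section \<open>Completeness of the space of square integrable functions\<close>

lemma norm_abs_l2:
  assumes "sq_integrable f"
  shows "ennreal ((norm (abs_l2 f))\<^sup>2) = (\<integral>\<^sup>+x. ennreal ((cmod (f x))\<^sup>2) \<partial>lborel)"
proof -
  have r: "l2rel f f" using assms by (simp add: l2rel_def)
  have "complex_of_real ((norm (abs_l2 f))\<^sup>2) = cinner (abs_l2 f) (abs_l2 f)"
    by (simp only: cinner_self_norm)
  also have "\<dots> = (LINT x|lborel. f x * cnj (f x))"
    using r by (simp add: cinner.abs_eq)
  also have "\<dots> = complex_of_real (LINT x|lborel. (cmod (f x))\<^sup>2)"
    by (subst integral_complex_of_real[symmetric]) (simp only: complex_norm_square)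
  finally have "(norm (abs_l2 f))\<^sup>2 = (LINT x|lborel. (cmod (f x))\<^sup>2)"
    by (simp only: of_real_eq_iff)
  then show ?thesis
    using assms by (simp add: nn_integral_eq_integral sq_integrable_def)
qed

lemma abs_l2_surj: obtains f where "sq_integrable f" "x = abs_l2 f"
  by (metis Quotient3_abs_rep Quotient3_l2 Quotient3_rep_reflp l2rel_def)

lemma abs_l2_diff: "sq_integrable f \<Longrightarrow> sq_integrable g \<Longrightarrow> abs_l2 f - abs_l2 g = abs_l2 (\<lambda>x. f x - g x)"
  by (simp add: minus_l2.abs_eq l2rel_def)

text \<open>
  The Riesz-Fischer argument. Along a subsequence \<open>r\<close> whose steps have norm below \<open>2\<^sup>-\<^sup>j\<close>, the weighted
  series \<open>\<Sum>\<^sub>j 2\<^sup>j a\<^sub>j(x)\<close> of the squared pointwise steps has a finite integral, hence converges almost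
  everywhere. The weights \<open>2\<^sup>j\<close> are there so that convergence of the squares forces convergence of the
  steps themselves, and thus of the subsequence. Fatou's lemma then controls the distance of the pointwise limit to the full sequence.
\<close>

lemma l2_Cauchy_convergent:
  fixes X :: "nat \<Rightarrow> 'a::euclidean_space l2"
  assumes "Cauchy X"
  shows "convergent X"
proof -
  have "\<exists>f. sq_integrable f \<and> X n = abs_l2 f" for n
    by (metis abs_l2_surj)
  then obtain f where sq: "\<And>n. sq_integrable (f n)" and X: "\<And>n. X n = abs_l2 (f n)"
    by metis
  have [measurable]: "f n \<in> borel_measurable borel" for n
    using sq by (rule sq_integrable_measurable)
  have nrm: "ennreal ((norm (X m - X n))\<^sup>2) = (\<integral>\<^sup>+x. ennreal ((cmod (f m x - f n x))\<^sup>2) \<partial>lborel)" for m n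
    by (simp add: X abs_l2_diff sq norm_abs_l2 sq_integrable_diff)
  have "\<exists>N. \<forall>m\<ge>N. \<forall>n\<ge>N. dist (X m) (X n) < (1/2) ^ j" for j :: nat
    using assms by (auto simp: Cauchy_def)
  then obtain N where N: "\<And>j m n. m \<ge> N j \<Longrightarrow> n \<ge> N j \<Longrightarrow> norm (X m - X n) < (1/2) ^ j"
    unfolding dist_norm by metis
  \<comment> \<open>adding \<open>j\<close> makes \<open>r\<close> unbounded, which the final appeal to Fatou's lemma needs\<close>
  define r where "r j = (\<Sum>i\<le>j. N i) + j" for j
  have rN: "r j \<ge> N j" for j
  proof -
    have "N j \<le> (\<Sum>i\<le>j. N i)" by (rule member_le_sum) auto
    then show ?thesis unfolding r_def by (rule trans_le_add1)
  qed
  have r_ge: "r j \<ge> j" for j by (simp add: r_def)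
  have r_mono: "r j \<le> r (Suc j)" for j by (simp add: r_def)
  have step: "norm (X (r (Suc j)) - X (r j)) < (1/2) ^ j" for j
    using rN[of j] r_mono[of j] by (intro N) auto
  define a where "a j x = (cmod (f (r (Suc j)) x - f (r j) x))\<^sup>2" for j x
  have [measurable]: "a j \<in> borel_measurable borel" for j
    unfolding a_def by measurable
  have "(\<integral>\<^sup>+x. (\<Sum>j. ennreal (2 ^ j * a j x)) \<partial>lborel) = (\<Sum>j. \<integral>\<^sup>+x. ennreal (2 ^ j * a j x) \<partial>lborel)"
    by (rule nn_integral_suminf) measurable
  also have "\<dots> \<le> (\<Sum>j. ennreal ((1/2) ^ j))"
  proof (intro suminf_le summableI)
    fix j
    have "(\<integral>\<^sup>+x. ennreal (2 ^ j * a j x) \<partial>lborel) = ennreal (2 ^ j) * (\<integral>\<^sup>+x. ennreal (a j x) \<partial>lborel)"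
      by (simp add: ennreal_mult a_def nn_integral_cmult)
    also have "(\<integral>\<^sup>+x. ennreal (a j x) \<partial>lborel) = ennreal ((norm (X (r (Suc j)) - X (r j)))\<^sup>2)"
      unfolding a_def nrm ..
    also have "ennreal (2 ^ j) * \<dots> \<le> ennreal (2 ^ j) * ennreal (((1/2) ^ j)\<^sup>2)"
      using step[of j] by (intro mult_left_mono ennreal_leI power_mono) auto
    also have "\<dots> = ennreal ((1/2) ^ j)"
      by (subst ennreal_mult[symmetric]) (simp_all add: power2_eq_square power_divide)
    finally show "(\<integral>\<^sup>+x. ennreal (2 ^ j * a j x) \<partial>lborel) \<le> ennreal ((1/2) ^ j)" .
  qed
  also have "\<dots> = ennreal (\<Sum>j. (1/2) ^ j)"
    by (rule suminf_ennreal2) (auto intro: summable_geometric)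
  also have "\<dots> < \<infinity>" by simp
  finally have "(\<integral>\<^sup>+x. (\<Sum>j. ennreal (2 ^ j * a j x)) \<partial>lborel) \<noteq> \<infinity>" by simp
  then have "AE x in lborel. (\<Sum>j. ennreal (2 ^ j * a j x)) \<noteq> \<infinity>"
    by (intro nn_integral_noteq_infinite) measurable
  then have conv: "AE x in lborel. convergent (\<lambda>j. f (r j) x)"
  proof eventually_elim
    case (elim x)
    have s: "summable (\<lambda>j. 2 ^ j * a j x)"
      using elim by (intro summable_suminf_not_top) (auto simp: a_def)
    have "summable (\<lambda>j. norm (f (r (Suc j)) x - f (r j) x))"
    proof (rule summable_comparison_test)
      show "summable (\<lambda>j. 2 ^ j * a j x + (1/2) ^ j)"
        by (intro summable_add s summable_geometric) simp
      \<comment> \<open>if \<open>t\<close> exceeds \<open>2\<^sup>-\<^sup>j\<close>, then \<open>2\<^sup>j t \<ge> 1\<close> and the quadratic term already dominates\<close>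
      have "t \<le> 2 ^ j * t\<^sup>2 + (1/2) ^ j" if "t \<ge> 0" for t :: real and j :: nat
      proof (cases "t \<le> (1/2) ^ j")
        case False
        then have "1 \<le> 2 ^ j * t" by (simp add: field_simps power_divide)
        then have "t \<le> 2 ^ j * t * t" using that by (simp add: mult_le_cancel_right1)
        then show ?thesis by (simp add: power2_eq_square mult.assoc add_increasing2)
      qed (simp add: add_increasing)
      then show "\<exists>N. \<forall>j\<ge>N. norm (norm (f (r (Suc j)) x - f (r j) x)) \<le> 2 ^ j * a j x + (1/2) ^ j"
        by (simp add: a_def)
    qed
    then have "summable (\<lambda>j. f (r (Suc j)) x - f (r j) x)"
      by (rule summable_norm_cancel)
    then have "convergent (\<lambda>j. f (r j) x - f (r 0) x)"
      by (simp add: summable_iff_convergent sum_lessThan_telescope[of "\<lambda>j. f (r j) x"])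
    then have "convergent (\<lambda>j. (f (r j) x - f (r 0) x) + f (r 0) x)"
      by (intro convergent_add convergent_const)
    then show ?case by simp
  qed
  define g where "g x = lim (\<lambda>j. f (r j) x)" for x
  have [measurable]: "g \<in> borel_measurable borel"
    unfolding g_def by (rule borel_measurable_lim_metric) measurable
  have fatou: "(\<integral>\<^sup>+x. ennreal ((cmod (g x - f m x))\<^sup>2) \<partial>lborel) \<le> ennreal (((1/2) ^ k)\<^sup>2)"
    if m: "m \<ge> N k" for m k
  proof -
    have "AE x in lborel. ennreal ((cmod (g x - f m x))\<^sup>2)
        = liminf (\<lambda>j. ennreal ((cmod (f (r j) x - f m x))\<^sup>2))"
      using conv
    proof eventually_elim
      case (elim x)
      then have "(\<lambda>j. f (r j) x) \<longlonglongrightarrow> g x"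
        by (simp add: g_def convergent_LIMSEQ_iff)
      then have "(\<lambda>j. ennreal ((cmod (f (r j) x - f m x))\<^sup>2)) \<longlonglongrightarrow> ennreal ((cmod (g x - f m x))\<^sup>2)"
        by (intro tendsto_intros tendsto_ennrealI)
      then show ?case
        by (intro lim_imp_Liminf[symmetric]) auto
    qed
    then have "(\<integral>\<^sup>+x. ennreal ((cmod (g x - f m x))\<^sup>2) \<partial>lborel)
        = (\<integral>\<^sup>+x. liminf (\<lambda>j. ennreal ((cmod (f (r j) x - f m x))\<^sup>2)) \<partial>lborel)"
      by (rule nn_integral_cong_AE)
    also have "\<dots> \<le> liminf (\<lambda>j. \<integral>\<^sup>+x. ennreal ((cmod (f (r j) x - f m x))\<^sup>2) \<partial>lborel)"
      by (rule nn_integral_liminf) measurable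
    also have "\<dots> = liminf (\<lambda>j. ennreal ((norm (X (r j) - X m))\<^sup>2))"
      by (simp only: nrm)
    also have "\<dots> \<le> ennreal (((1/2) ^ k)\<^sup>2)"
    proof (rule order_trans[OF Liminf_le_Limsup Limsup_bounded])
      show "\<forall>\<^sub>F j in sequentially. ennreal ((norm (X (r j) - X m))\<^sup>2) \<le> ennreal (((1/2) ^ k)\<^sup>2)"
        using eventually_ge_at_top[of "N k"]
      proof eventually_elim
        case (elim j)
        then have "norm (X (r j) - X m) < (1/2) ^ k"
          using r_ge[of j] m by (intro N) auto
        then show ?case by (intro ennreal_leI power_mono) auto
      qed
    qed simp
    finally show ?thesis .
  qed
  have sqd: "sq_integrable (\<lambda>x. g x - f (N 0) x)"
    unfolding sq_integrable_def
  proof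
    show "integrable lborel (\<lambda>x. (cmod (g x - f (N 0) x))\<^sup>2)"
      using fatou[of 0 "N 0"] by (intro integrableI_bounded) (auto simp: le_less_trans)
  qed measurable
  have sqg: "sq_integrable g"
    using sq_integrable_add[OF sqd sq[of "N 0"]] by simp
  have "norm (abs_l2 g - X m) \<le> (1/2) ^ k" if "m \<ge> N k" for m k
  proof -
    have "ennreal ((norm (abs_l2 g - X m))\<^sup>2) \<le> ennreal (((1/2) ^ k)\<^sup>2)"
      using fatou[OF that] sqg sq by (simp add: X abs_l2_diff norm_abs_l2 sq_integrable_diff)
    then have "(norm (abs_l2 g - X m))\<^sup>2 \<le> ((1/2) ^ k)\<^sup>2"
      by simp
    then show ?thesis
      by (rule power2_le_imp_le) simp
  qed
  note close = this
  have "X \<longlonglongrightarrow> abs_l2 g"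
  proof (rule metric_LIMSEQ_I)
    fix e :: real assume "e > 0"
    then obtain k where "(1/2) ^ k < e"
      using real_arch_pow_inv[of e "1/2"] by auto
    then show "\<exists>no. \<forall>n\<ge>no. dist (X n) (abs_l2 g) < e"
      using close by (metis dist_commute dist_norm le_less_trans)
  qed
  then show ?thesis
    by (rule convergentI)
qed

instance l2 :: (euclidean_space) complete_space
  by standard (rule l2_Cauchy_convergent)

section \<open>Orthonormal families, bases and sesquilinear forms\<close>

definition orthonormal_on :: "'i set \<Rightarrow> ('i \<Rightarrow> 'a::euclidean_space l2) \<Rightarrow> bool" where
  "orthonormal_on I e \<longleftrightarrow> (\<forall>i\<in>I. \<forall>j\<in>I. cinner (e i) (e j) = (if i = j then 1 else 0))"

lemma orthonormal_seq_iff: "orthonormal_seq e \<longleftrightarrow> orthonormal_on UNIV e"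
  by (simp add: orthonormal_seq_def orthonormal_on_def)

lemma orthonormal_basis_imp_orthonormal_on: "orthonormal_basis B \<Longrightarrow> orthonormal_on B (\<lambda>b. b)"
  by (simp add: orthonormal_basis_def orthonormal_on_def)

lemma orthonormal_on_norm:
  assumes "orthonormal_on I e" "i \<in> I"
  shows "norm (e i) = 1"
proof -
  have "complex_of_real ((norm (e i))\<^sup>2) = of_real 1"
    using assms by (simp only: cinner_self_norm[symmetric]) (simp add: orthonormal_on_def)
  then have "(norm (e i))\<^sup>2 = 1" by (simp only: of_real_eq_iff)
  then show ?thesis using norm_ge_zero[of "e i"] by (auto simp: power2_eq_1_iff simp del: norm_ge_zero)
qed

lemma cinner_sum_orthonormal:
  assumes "orthonormal_on I e" "finite F" "F \<subseteq> I" "j \<in> I"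
  shows "cinner (\<Sum>i\<in>F. c i *\<^sub>C e i) (e j) = (if j \<in> F then c j else 0)"
proof -
  have "cinner (\<Sum>i\<in>F. c i *\<^sub>C e i) (e j) = (\<Sum>i\<in>F. if i = j then c i else 0)"
    unfolding cinner_sum_left cinner_scaleC_left
    using assms by (intro sum.cong refl) (auto simp: orthonormal_on_def)
  then show ?thesis using assms by simp
qed

lemma norm_sum_orthonormal:
  assumes "orthonormal_on I e" "finite F" "F \<subseteq> I"
  shows "(norm (\<Sum>i\<in>F. c i *\<^sub>C e i))\<^sup>2 = (\<Sum>i\<in>F. (cmod (c i))\<^sup>2)"
proof -
  have "complex_of_real ((norm (\<Sum>i\<in>F. c i *\<^sub>C e i))\<^sup>2)
      = (\<Sum>j\<in>F. cnj (c j) * cinner (\<Sum>i\<in>F. c i *\<^sub>C e i) (e j))"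
    by (simp only: cinner_self_norm[symmetric]) (simp add: cinner_sum_right cinner_scaleC_right)
  also have "\<dots> = (\<Sum>j\<in>F. complex_of_real ((cmod (c j))\<^sup>2))"
    using assms cinner_sum_orthonormal[OF assms, of _ c]
    by (intro sum.cong refl) (auto simp: complex_norm_square mult.commute simp del: of_real_power)
  finally show ?thesis
    by (simp only: of_real_sum[symmetric] of_real_eq_iff)
qed

text \<open>
  Bessel's inequality for an antilinear functional instead of a vector: testing \<open>\<Phi>\<close> on the vector with
  coordinates \<open>\<Phi> (e i)\<close> gives the square of its norm. The case \<open>\<Phi> = cinner x\<close> is the usual inequality; the
  general case serves to represent functionals that are not yet known to come from a vector.
\<close>

lemma Bessel_antilinear:
  assumes e: "orthonormal_on I e" "finite F" "F \<subseteq> I"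
    and add: "\<And>x y. \<Phi> (x + y) = \<Phi> x + \<Phi> y" and scale: "\<And>c x. \<Phi> (c *\<^sub>C x) = cnj c * \<Phi> x"
    and bound: "\<And>x. cmod (\<Phi> x) \<le> K * norm x" and "0 \<le> K"
  shows "(\<Sum>i\<in>F. (cmod (\<Phi> (e i)))\<^sup>2) \<le> K\<^sup>2"
proof -
  define y where "y = (\<Sum>i\<in>F. \<Phi> (e i) *\<^sub>C e i)"
  have zero: "\<Phi> 0 = 0" using scale[of 0 0] by simp
  have sum: "\<Phi> (\<Sum>i\<in>F. u i) = (\<Sum>i\<in>F. \<Phi> (u i))" for u
    by (induction F rule: infinite_finite_induct) (simp_all add: zero add)
  have ny: "(norm y)\<^sup>2 = (\<Sum>i\<in>F. (cmod (\<Phi> (e i)))\<^sup>2)"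
    unfolding y_def using norm_sum_orthonormal[OF e] .
  have "\<Phi> y = (\<Sum>i\<in>F. cnj (\<Phi> (e i)) * \<Phi> (e i))"
    by (simp add: y_def sum scale)
  also have "\<dots> = complex_of_real (\<Sum>i\<in>F. (cmod (\<Phi> (e i)))\<^sup>2)"
    by (simp add: complex_norm_square mult.commute del: of_real_power)
  finally have eq: "\<Phi> y = complex_of_real ((norm y)\<^sup>2)" by (simp only: ny)
  have "(norm y)\<^sup>2 \<le> K * norm y"
    using bound[of y] unfolding eq norm_of_real by (simp only: abs_power2 abs_of_nonneg zero_le_power2)
  then have "norm y \<le> K"
    using \<open>0 \<le> K\<close> by (auto simp: power2_eq_square mult_le_cancel_right)
  then show ?thesis unfolding ny[symmetric] by (auto intro: power_mono)
qed

lemma Bessel_finite: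
  assumes "orthonormal_on I e" "finite F" "F \<subseteq> I"
  shows "(\<Sum>i\<in>F. (cmod (cinner x (e i)))\<^sup>2) \<le> (norm x)\<^sup>2"
  by (rule Bessel_antilinear[OF assms, of "cinner x"])
    (simp_all add: cinner_add_right cinner_scaleC_right cmod_cinner_le)

lemma Bessel_product_finite:
  assumes "orthonormal_on I e" "finite F" "F \<subseteq> I"
  shows "(\<Sum>i\<in>F. cmod (cinner x (e i)) * cmod (cinner y (e i))) \<le> norm x * norm y"
proof -
  have "L2_set (\<lambda>i. cmod (cinner x (e i))) F \<le> norm x" for x
    unfolding L2_set_def using Bessel_finite[OF assms, of x] by (intro real_le_lsqrt) auto
  note b = this
  have "(\<Sum>i\<in>F. cmod (cinner x (e i)) * cmod (cinner y (e i)))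
      \<le> L2_set (\<lambda>i. cmod (cinner x (e i))) F * L2_set (\<lambda>i. cmod (cinner y (e i))) F"
    using L2_set_mult_ineq[of "\<lambda>i. cmod (cinner x (e i))" "\<lambda>i. cmod (cinner y (e i))" F] by simp
  also have "\<dots> \<le> norm x * norm y"
    by (intro mult_mono b) (auto simp: L2_set_nonneg)
  finally show ?thesis .
qed

text \<open>
  The unordered series need not converge absolutely in norm, so this goes through the Cauchy criterion:
  by Pythagoras, partial sums over nested index sets differ by the square root of a tail of
  \<open>\<Sum>\<^sub>i \<bar>c\<^sub>i\<bar>\<^sup>2\<close>.
\<close>

lemma summable_on_orthonormal:
  assumes e: "orthonormal_on I e"
    and bound: "\<And>F. finite F \<Longrightarrow> F \<subseteq> I \<Longrightarrow> (\<Sum>i\<in>F. (cmod (c i))\<^sup>2) \<le> K"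
  shows "(\<lambda>i. c i *\<^sub>C e i) summable_on I"
proof -
  let ?f = "\<lambda>i. c i *\<^sub>C e i" and ?q = "\<lambda>i. (cmod (c i))\<^sup>2"
  have "?q summable_on I"
    using bound by (intro nonneg_bdd_above_summable_on) (auto simp: bdd_above_def)
  then obtain L where L: "(?q has_sum L) I"
    by (auto simp: summable_on_def)
  have le_L: "sum ?q F \<le> L" if "finite F" "F \<subseteq> I" for F
    by (rule has_sum_mono_neutral[OF has_sum_finite[OF that(1)] L]) (use that in auto)
  have "\<exists>P. eventually P (finite_subsets_at_top I) \<and>
          (\<forall>F F'. P F \<and> P F' \<longrightarrow> dist (sum ?f F) (sum ?f F') < r)" if "r > 0" for r
  proof -
    define P where "P F \<longleftrightarrow> (finite F \<and> F \<subseteq> I) \<and> dist (sum ?q F) L < (r/2)\<^sup>2" for F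
    have "eventually (\<lambda>F. dist (sum ?q F) L < (r/2)\<^sup>2) (finite_subsets_at_top I)"
      using L \<open>r > 0\<close> unfolding has_sum_def by (intro tendstoD) auto
    then have ev: "eventually P (finite_subsets_at_top I)"
      unfolding P_def by (intro eventually_conj) (auto intro: eventually_finite_subsets_at_top_weakI)
    have sub: "dist (sum ?f G) (sum ?f F) < r/2" if "P F" "finite G" "F \<subseteq> G" "G \<subseteq> I" for F G
    proof -
      have "(dist (sum ?f G) (sum ?f F))\<^sup>2 = (norm (sum ?f (G - F)))\<^sup>2"
        using that by (simp add: dist_norm sum_diff)
      also have "\<dots> = sum ?q (G - F)"
        using that by (intro norm_sum_orthonormal[OF e]) auto
      also have "\<dots> = sum ?q G - sum ?q F"
        using that by (simp add: sum_diff)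
      also have "\<dots> < (r/2)\<^sup>2"
        using le_L[of G] that by (auto simp: P_def dist_real_def)
      finally show ?thesis
        by (rule power2_less_imp_less) (use \<open>r > 0\<close> in simp)
    qed
    have "dist (sum ?f F) (sum ?f F') < r" if "P F" "P F'" for F F'
    proof -
      have "dist (sum ?f F) (sum ?f F')
          \<le> dist (sum ?f (F \<union> F')) (sum ?f F) + dist (sum ?f (F \<union> F')) (sum ?f F')"
        by (rule dist_triangle3)
      also have "\<dots> < r/2 + r/2"
        using that by (intro add_strict_mono sub) (auto simp: P_def)
      finally show ?thesis by simp
    qed
    then show ?thesis using ev by blast
  qed
  then have "cauchy_filter (filtermap (sum ?f) (finite_subsets_at_top I))"
    by (simp add: cauchy_filter_metric_filtermap)
  moreover have "complete (UNIV :: 'b l2 set)"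
    by (meson Cauchy_convergent UNIV_I complete_def convergent_def)
  ultimately obtain L' where "(sum ?f \<longlongrightarrow> L') (finite_subsets_at_top I)"
    using complete_uniform[where S=UNIV] by (force simp add: filterlim_def)
  then show ?thesis
    by (auto simp: summable_on_def has_sum_def)
qed

lemma has_sum_cinner_left:
  "(f has_sum x) I \<Longrightarrow> ((\<lambda>i. cinner (f i) y) has_sum cinner x y) I"
  by (rule has_sum_bounded_linear[OF bounded_linear_cinner_left])

lemma coefficient_has_sum_orthonormal:
  assumes e: "orthonormal_on I e" and s: "((\<lambda>i. c i *\<^sub>C e i) has_sum x) I" and "j \<in> I"
  shows "cinner x (e j) = c j"
proof -
  have "((\<lambda>i. cinner (c i *\<^sub>C e i) (e j)) has_sum cinner x (e j)) I"
    by (rule has_sum_cinner_left[OF s])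
  moreover have "((\<lambda>i. cinner (c i *\<^sub>C e i) (e j)) has_sum c j) I"
  proof (rule has_sum_finite_neutralI[of "{j}"])
    show "cinner (c i *\<^sub>C e i) (e j) = 0" if "i \<in> I - {j}" for i
      using e that \<open>j \<in> I\<close> by (auto simp: orthonormal_on_def cinner_scaleC_left)
  qed (use e \<open>j \<in> I\<close> in \<open>auto simp: orthonormal_on_def cinner_scaleC_left\<close>)
  ultimately show ?thesis by (rule has_sum_unique)
qed

lemma orthonormal_projection:
  assumes e: "orthonormal_on I e"
  obtains p where "((\<lambda>i. cinner x (e i) *\<^sub>C e i) has_sum p) I"
    and "\<And>j. j \<in> I \<Longrightarrow> cinner (x - p) (e j) = 0"
proof -
  have "(\<lambda>i. cinner x (e i) *\<^sub>C e i) summable_on I"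
    by (rule summable_on_orthonormal[OF e Bessel_finite[OF e]])
  then obtain p where p: "((\<lambda>i. cinner x (e i) *\<^sub>C e i) has_sum p) I"
    by (auto simp: summable_on_def)
  show ?thesis
    by (rule that[OF p]) (simp add: cinner_diff_left coefficient_has_sum_orthonormal[OF e p])
qed

lemma orthonormal_basis_expansion:
  assumes "orthonormal_basis B"
  shows "((\<lambda>b. cinner x b *\<^sub>C b) has_sum x) B"
proof -
  obtain p where p: "((\<lambda>b. cinner x b *\<^sub>C b) has_sum p) B" "\<And>b. b \<in> B \<Longrightarrow> cinner (x - p) b = 0"
    using orthonormal_projection[OF orthonormal_basis_imp_orthonormal_on[OF assms]] by metis
  then have "x - p = 0"
    using assms unfolding orthonormal_basis_def by blast
  then have "x = p" by simp
  with p(1) show ?thesis by (simp only:)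
qed

lemma Parseval:
  assumes "orthonormal_basis B"
  shows "((\<lambda>b. cinner x b * cinner b y) has_sum cinner x y) B"
  using has_sum_cinner_left[OF orthonormal_basis_expansion[OF assms, of x], of y]
  by (simp add: cinner_scaleC_left)

text \<open>
  A maximal orthonormal set has trivial orthogonal complement, since a normalised vector of the
  complement could be added to it. Existence matters because a trace described by a condition on all
  bases would be arbitrary if there were none.
\<close>

lemma orthonormal_basis_exists: "\<exists>B :: 'a::euclidean_space l2 set. orthonormal_basis B"
proof -
  let ?ON = "{B :: 'a l2 set. orthonormal_on B (\<lambda>b. b)}"
  have "\<exists>M\<in>?ON. \<forall>X\<in>?ON. M \<subseteq> X \<longrightarrow> X = M"
  proof (rule Zorn_Lemma, intro ballI)
    fix C assume "C \<in> chains ?ON"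
    then have C: "C \<subseteq> ?ON" "\<And>X Y. X \<in> C \<Longrightarrow> Y \<in> C \<Longrightarrow> X \<subseteq> Y \<or> Y \<subseteq> X"
      unfolding chains_def chain_subset_def by blast+
    have "cinner x y = (if x = y then 1 else 0)" if mem: "X \<in> C" "Y \<in> C" "x \<in> X" "y \<in> Y" for x y X Y
    proof -
      obtain Z where "Z \<in> C" "x \<in> Z" "y \<in> Z"
        using C(2)[OF mem(1,2)] mem by (meson subsetD)
      then have "orthonormal_on Z (\<lambda>b. b)" using C(1) by blast
      then show ?thesis using \<open>x \<in> Z\<close> \<open>y \<in> Z\<close> by (simp add: orthonormal_on_def)
    qed
    then show "\<Union>C \<in> ?ON" unfolding orthonormal_on_def by blast
  qed
  then obtain M where "M \<in> ?ON" and "\<forall>X\<in>?ON. M \<subseteq> X \<longrightarrow> X = M" ..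
  then have M: "orthonormal_on M (\<lambda>b. b)"
    and max: "\<And>X. orthonormal_on X (\<lambda>b. b) \<Longrightarrow> M \<subseteq> X \<Longrightarrow> X = M"
    by simp_all
  have "x = 0" if x: "\<And>b. b \<in> M \<Longrightarrow> cinner x b = 0" for x
  proof (rule ccontr)
    assume "x \<noteq> 0"
    define u where "u = (1 / norm x) *\<^sub>R x"
    have "norm u = 1" using \<open>x \<noteq> 0\<close> by (simp add: u_def)
    then have uu: "cinner u u = 1" using cinner_self_norm[of u] by simp
    have ub: "cinner u b = 0" if "b \<in> M" for b
      using x[OF that] by (simp add: u_def cinner_scaleR_left)
    have bu: "cinner b u = 0" if "b \<in> M" for b
      using cinner_commute[of b u] ub[OF that] by simp
    have "orthonormal_on (insert u M) (\<lambda>b. b)"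
      using M uu ub bu by (auto simp: orthonormal_on_def)
    then have "insert u M = M" using max[of "insert u M"] by (simp add: subset_insertI)
    then have "u \<in> M" by blast
    then show False using ub[of u] uu by simp
  qed
  then have "\<forall>x. (\<forall>b\<in>M. cinner x b = 0) \<longrightarrow> x = 0"
    by blast
  then have "orthonormal_basis M"
    using M unfolding orthonormal_basis_def orthonormal_on_def by (intro conjI)
  then show ?thesis ..
qed

text \<open>
  The Riesz representation in coordinates: the vector representing \<open>\<Phi> x\<close> must have the coordinates \<open>\<Phi> x b\<close>
  with respect to a basis, and the antilinear form of Bessel's inequality makes these square summable.
\<close>

lemma sesquilinear_representation:
  fixes \<Phi> :: "'a::euclidean_space l2 \<Rightarrow> 'a l2 \<Rightarrow> complex"
  assumes add1: "\<And>x y z. \<Phi> (x + y) z = \<Phi> x z + \<Phi> y z" and scale1: "\<And>c x z. \<Phi> (c *\<^sub>C x) z = c * \<Phi> x z"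
    and add2: "\<And>x y z. \<Phi> x (y + z) = \<Phi> x y + \<Phi> x z" and scale2: "\<And>c x z. \<Phi> x (c *\<^sub>C z) = cnj c * \<Phi> x z"
    and bound: "\<And>x y. cmod (\<Phi> x y) \<le> K * norm x * norm y" and "0 \<le> K"
  shows "\<exists>A. bounded_clinear A \<and> (\<forall>x y. cinner (A x) y = \<Phi> x y)"
proof -
  obtain B :: "'a l2 set" where B: "orthonormal_basis B"
    using orthonormal_basis_exists by blast
  note on = orthonormal_basis_imp_orthonormal_on[OF B]
  have "\<exists>v. \<forall>y. cinner v y = \<Phi> x y" for x
  proof -
    have "(\<lambda>b. \<Phi> x b *\<^sub>C b) summable_on B"
      by (rule summable_on_orthonormal[OF on Bessel_antilinear[OF on, where K = "K * norm x"]])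
        (auto simp: add2 scale2 bound \<open>0 \<le> K\<close>)
    then obtain v where v: "((\<lambda>b. \<Phi> x b *\<^sub>C b) has_sum v) B"
      by (auto simp: summable_on_def)
    have "cinner v y = \<Phi> x y" for y
    proof (rule has_sum_unique)
      show "((\<lambda>b. \<Phi> x b * cinner b y) has_sum cinner v y) B"
        using has_sum_cinner_left[OF v, of y] by (simp add: cinner_scaleC_left)
      have bl: "bounded_linear (\<Phi> x)"
        by (rule bounded_linear_intro[where K = "K * norm x"])
          (use bound[of x] in \<open>simp_all add: add2 scale2 scaleR_l2_def scaleR_conv_of_real mult_ac\<close>)
      have "((\<lambda>b. \<Phi> x (cinner y b *\<^sub>C b)) has_sum \<Phi> x y) B"
        by (rule has_sum_bounded_linear[OF bl orthonormal_basis_expansion[OF B]])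
      then show "((\<lambda>b. \<Phi> x b * cinner b y) has_sum \<Phi> x y) B"
        by (simp add: scale2 cinner_commute[of _ y, symmetric] mult.commute)
    qed
    then show ?thesis by blast
  qed
  then obtain A where A: "\<And>x y. cinner (A x) y = \<Phi> x y" by metis
  have scale: "A (c *\<^sub>C x) = c *\<^sub>C A x" for c x
    by (rule l2_eqI) (simp add: A scale1 cinner_scaleC_left)
  have "bounded_linear A"
  proof (rule bounded_linear_intro[where K = K])
    show "A (x + y) = A x + A y" for x y
      by (rule l2_eqI) (simp add: A add1 cinner_add_left)
    show "A (r *\<^sub>R x) = r *\<^sub>R A x" for r x
      by (simp add: scaleR_l2_def scale)
    show "norm (A x) \<le> norm x * K" for x
    proof -
      have "(norm (A x))\<^sup>2 = cmod (\<Phi> x (A x))"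
        by (simp only: A[symmetric] cinner_self_norm norm_of_real) simp
      also have "\<dots> \<le> (norm x * K) * norm (A x)"
        using bound[of x "A x"] by (simp add: mult_ac)
      finally have "norm (A x) \<le> norm x * K \<or> norm (A x) = 0"
        by (auto simp: power2_eq_square mult_le_cancel_right)
      then show ?thesis using \<open>0 \<le> K\<close> by auto
    qed
  qed
  then show ?thesis
    using A scale by (auto simp: bounded_clinear_def)
qed

section \<open>Traces\<close>

text \<open>
  The exchange of summations used for all trace computations: one index is a sequence with a summable
  bound, the other ranges over an arbitrary basis.
\<close>

lemma has_sum_swap_sums:
  fixes g :: "nat \<Rightarrow> 'i \<Rightarrow> complex"
  assumes bound: "\<And>n F. finite F \<Longrightarrow> F \<subseteq> B \<Longrightarrow> (\<Sum>b\<in>F. cmod (g n b)) \<le> c n"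
    and c: "summable c"
    and rows: "\<And>n. (g n has_sum a n) B"
    and cols: "\<And>b. b \<in> B \<Longrightarrow> (\<lambda>n. g n b) sums G b"
  shows "(G has_sum (\<Sum>n. a n)) B"
proof -
  have row: "(\<lambda>b. cmod (g n b)) summable_on B" for n
    using bound[of _ n] by (intro nonneg_bdd_above_summable_on) (auto simp: bdd_above_def)
  define m where "m n = (\<Sum>\<^sub>\<infinity>b\<in>B. cmod (g n b))" for n
  have m_le: "m n \<le> c n" for n
    unfolding m_def using bound by (intro infsum_le_finite_sums row)
  have m_nonneg: "0 \<le> m n" for n
    unfolding m_def by (intro infsum_nonneg) simp
  have "summable m"
    by (rule summable_comparison_test'[OF c, of 0]) (simp add: m_le m_nonneg)
  then have "m summable_on UNIV"
    using m_nonneg by (simp add: summable_on_UNIV_nonneg_real_iff)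
  then have "(\<lambda>p. norm (g (fst p) (snd p))) summable_on (UNIV \<times> B)"
    by (subst Infinite_Sum.abs_summable_on_Sigma_iff) (simp add: row m_def[symmetric] m_nonneg)
  then have "(\<lambda>p. g (fst p) (snd p)) summable_on (UNIV \<times> B)"
    by (rule abs_summable_summable)
  then obtain t where t: "((\<lambda>p. g (fst p) (snd p)) has_sum t) (UNIV \<times> B)"
    by (auto simp: summable_on_def)
  have "(a has_sum t) UNIV"
    by (rule has_sum_SigmaD[OF t]) (simp add: rows)
  then have t_eq: "t = (\<Sum>n. a n)"
    by (simp add: has_sum_imp_sums sums_unique)
  have "((\<lambda>(b, n). g n b) has_sum t) (B \<times> UNIV)"
    using t by (subst (asm) has_sum_swap) (simp add: case_prod_unfold)
  then show ?thesis
    unfolding t_eq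
  proof (rule has_sum_SigmaD)
    fix b assume b: "b \<in> B"
    have "summable (\<lambda>n. cmod (g n b))"
      by (rule summable_comparison_test'[OF c, of 0]) (use bound[of "{b}"] b in simp)
    then show "((\<lambda>n. (\<lambda>(b, n). g n b) (b, n)) has_sum G b) UNIV"
      using cols[OF b] by (simp add: norm_summable_imp_has_sum)
  qed
qed

text \<open>
  A singular value expansion without the orthogonality. Only the norms of the vectors enter the
  estimates, and in this form the expansion is visibly preserved by unitary conjugation.
\<close>

definition nuclear_series ::
  "(nat \<Rightarrow> real) \<Rightarrow> (nat \<Rightarrow> 'a::euclidean_space l2) \<Rightarrow> (nat \<Rightarrow> 'a l2) \<Rightarrow> ('a l2 \<Rightarrow> 'a l2) \<Rightarrow> bool" where
  "nuclear_series s e f T \<longleftrightarrow> (\<forall>n. 0 \<le> s n) \<and> summable s \<and> (\<forall>n. norm (e n) \<le> 1) \<and> (\<forall>n. norm (f n) \<le> 1) \<and>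
     (\<forall>x. (\<lambda>n. s n *\<^sub>R (e n \<otimes>\<^sub>o f n) x) sums T x)"

lemma trace_class_nuclear_series:
  assumes "trace_class T"
  obtains s e f where "nuclear_series s e f T"
proof -
  obtain s e f where s: "\<forall>n. 0 \<le> s n" "summable s" and on: "orthonormal_seq e" "orthonormal_seq f"
    and T: "\<forall>x. (\<lambda>n. s n *\<^sub>R (e n \<otimes>\<^sub>o f n) x) sums T x"
    using assms unfolding trace_class_def by (elim conjE exE)
  have "norm (e n) = 1" "norm (f n) = 1" for n
    using on orthonormal_on_norm[of UNIV _ n] by (auto simp: orthonormal_seq_iff)
  then have "nuclear_series s e f T"
    using s T by (simp add: nuclear_series_def)
  then show ?thesis by (rule that)
qed

lemma bounded_clinear_bounded_linear: "bounded_clinear A \<Longrightarrow> bounded_linear A"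
  by (simp add: bounded_clinear_def)

lemma nuclear_series_comp:
  assumes S: "bounded_clinear S" and T: "nuclear_series s e f T"
  shows "(\<lambda>n. of_real (s n) * (cinner x (f n) * cinner (S (e n)) y)) sums cinner (S (T x)) y"
proof -
  have "(\<lambda>n. cinner (S (s n *\<^sub>R (e n \<otimes>\<^sub>o f n) x)) y) sums cinner (S (T x)) y"
    using T by (intro bounded_linear.sums[OF bounded_linear_cinner_left]
        bounded_linear.sums[OF bounded_clinear_bounded_linear[OF S]]) (simp add: nuclear_series_def)
  moreover have "S (r *\<^sub>R c *\<^sub>C u) = (of_real r * c) *\<^sub>C S u" for r c u
    using S by (simp add: scaleR_scaleC bounded_clinear_def)
  ultimately show ?thesis
    by (simp add: cinner_scaleC_left rank_one_def mult.assoc)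
qed

lemma nuclear_series_cinner_sums:
  assumes "nuclear_series s e f T"
  shows "(\<lambda>n. of_real (s n) * (cinner x (f n) * cinner (e n) y)) sums cinner (T x) y"
  using nuclear_series_comp[of "\<lambda>x. x", OF _ assms] by (simp add: bounded_clinear_def bounded_linear_ident)

text \<open>
  Expanding \<open>T\<close> in \<open>tr(S T) = \<Sum>\<^sub>b \<langle>S T b, b\<rangle>\<close> gives a double series whose inner sum over the basis is, by Parseval,
  \<open>\<langle>S e\<^sub>n, f\<^sub>n\<rangle>\<close>. Hence every basis gives the same value.
\<close>

lemma trace_has_sum:
  assumes S: "bounded_clinear S" and T: "nuclear_series s e f T" and B: "orthonormal_basis B"
  shows "((\<lambda>b. cinner ((S \<circ> T) b) b) has_sum (\<Sum>n. of_real (s n) * cinner (S (e n)) (f n))) B"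
proof (rule has_sum_swap_sums)
  note on = orthonormal_basis_imp_orthonormal_on[OF B]
  have bS: "bounded_linear S" using S by (rule bounded_clinear_bounded_linear)
  show "(\<Sum>b\<in>F. cmod (of_real (s n) * (cinner b (f n) * cinner (S (e n)) b))) \<le> s n * onorm S"
    if F: "finite F" "F \<subseteq> B" for n F
  proof -
    have sn: "0 \<le> s n" and en: "norm (e n) \<le> 1" and fn: "norm (f n) \<le> 1"
      using T by (auto simp: nuclear_series_def)
    have "(\<Sum>b\<in>F. cmod (of_real (s n) * (cinner b (f n) * cinner (S (e n)) b)))
        = s n * (\<Sum>b\<in>F. cmod (cinner (f n) b) * cmod (cinner (S (e n)) b))"
      using sn by (simp add: norm_mult sum_distrib_left cinner_commute[of _ "f n"])
    also have "\<dots> \<le> s n * (norm (f n) * norm (S (e n)))"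
      by (intro mult_left_mono Bessel_product_finite[OF on F] sn)
    also have "\<dots> \<le> s n * (1 * (onorm S * 1))"
      using en fn
      by (intro mult_left_mono mult_mono sn order_trans[OF onorm[OF bS]] onorm_pos_le[OF bS])
         (auto simp: onorm_pos_le[OF bS])
    finally show ?thesis by simp
  qed
  show "summable (\<lambda>n. s n * onorm S)"
    using T by (intro summable_mult2) (simp add: nuclear_series_def)
  show "((\<lambda>b. of_real (s n) * (cinner b (f n) * cinner (S (e n)) b)) has_sum
      of_real (s n) * cinner (S (e n)) (f n)) B" for n
    using has_sum_cmult_right[OF Parseval[OF B, of "S (e n)" "f n"], of "of_real (s n)"]
    by (simp add: mult_ac)
  show "(\<lambda>n. of_real (s n) * (cinner b (f n) * cinner (S (e n)) b)) sums cinner ((S \<circ> T) b) b" for b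
    using nuclear_series_comp[OF S T, of b b] by simp
qed

lemma trace_op_eqI:
  fixes A :: "'a::euclidean_space l2 \<Rightarrow> 'a l2"
  assumes "\<And>B. orthonormal_basis B \<Longrightarrow> ((\<lambda>b. cinner (A b) b) has_sum t) B"
  shows "trace_op A = t"
  unfolding trace_op_def
proof (rule the_equality)
  fix u assume u: "\<forall>B. orthonormal_basis B \<longrightarrow> ((\<lambda>b. cinner (A b) b) has_sum u) B"
  obtain B :: "'a l2 set" where "orthonormal_basis B"
    using orthonormal_basis_exists by blast
  then show "u = t"
    using u assms has_sum_unique by blast
qed (use assms in blast)

lemma trace_op_comp_nuclear_series:
  assumes "bounded_clinear S" "nuclear_series s e f T"
  shows "trace_op (S \<circ> T) = (\<Sum>n. of_real (s n) * cinner (S (e n)) (f n))"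
  by (rule trace_op_eqI) (rule trace_has_sum[OF assms])

lemma trace_op_comp_rank_one:
  assumes S: "bounded_clinear S"
  shows "trace_op (S \<circ> (x \<otimes>\<^sub>o y)) = cinner (S x) y"
proof (rule trace_op_eqI)
  fix B :: "'a l2 set" assume B: "orthonormal_basis B"
  have "cinner ((S \<circ> (x \<otimes>\<^sub>o y)) b) b = cinner (S x) b * cinner b y" for b
    using S by (simp add: rank_one_def bounded_clinear_def cinner_scaleC_left mult.commute)
  then show "((\<lambda>b. cinner ((S \<circ> (x \<otimes>\<^sub>o y)) b) b) has_sum cinner (S x) y) B"
    using Parseval[OF B, of "S x" y] by simp
qed

section \<open>Time-frequency shifts\<close>

lemma l2rel_tf_shift:
  "l2rel f f \<Longrightarrow> l2rel (\<lambda>t. exp (2 * of_real pi * \<i> * of_real (snd z \<bullet> t)) * f (t - fst z))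
     (\<lambda>t. exp (2 * of_real pi * \<i> * of_real (snd z \<bullet> t)) * f (t - fst z))"
  using tf_shift.rsp[THEN rel_funD, THEN rel_funD, OF refl, of f f z] by (simp add: case_prod_unfold)

lemma integral_lborel_translate:
  fixes u :: "'a::euclidean_space \<Rightarrow> complex"
  assumes [measurable]: "u \<in> borel_measurable borel"
  shows "(LINT t|lborel. u (t - a)) = (LINT t|lborel. u t)"
proof -
  have "(LINT t|lborel. u t) = (LINT t|distr lborel borel (\<lambda>t. t - a). u t)"
    by (simp add: lborel_distr_translate)
  then show ?thesis
    by (simp add: integral_distr)
qed

lemma integral_lborel_reflect:
  fixes u :: "'a::euclidean_space \<Rightarrow> complex"
  assumes [measurable]: "u \<in> borel_measurable borel"
  shows "(LINT t|lborel. u (- t)) = (LINT t|lborel. u t)"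
proof -
  have "(LINT t|lborel. u t) = (LINT t|distr lborel borel uminus. u t)"
    by (simp add: lborel_distr_reflect)
  then show ?thesis
    by (simp add: integral_distr)
qed

lemma cinner_tf_shift: "cinner (tf_shift z x) (tf_shift z y) = cinner x y"
proof transfer
  fix z :: "'a \<times> 'a" and f g :: "'a \<Rightarrow> complex"
  assume "l2rel f f" "l2rel g g"
  then have [measurable]: "f \<in> borel_measurable borel" "g \<in> borel_measurable borel"
    by (auto simp: l2rel_def dest: sq_integrable_measurable)
  let ?E = "\<lambda>t. exp (2 * of_real pi * \<i> * of_real (snd z \<bullet> t)) :: complex"
  have E: "?E t * cnj (?E t) = 1" for t
    unfolding complex_norm_square[symmetric] by simp
  have "(LINT t|lborel. (?E t * f (t - fst z)) * cnj (?E t * g (t - fst z)))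
      = (LINT t|lborel. f (t - fst z) * cnj (g (t - fst z)))"
  proof (rule Bochner_Integration.integral_cong[OF refl])
    fix t
    have "(?E t * f (t - fst z)) * cnj (?E t * g (t - fst z))
        = (?E t * cnj (?E t)) * (f (t - fst z) * cnj (g (t - fst z)))"
      by (simp only: complex_cnj_mult mult_ac)
    then show "(?E t * f (t - fst z)) * cnj (?E t * g (t - fst z)) = f (t - fst z) * cnj (g (t - fst z))"
      by (simp only: E mult_1)
  qed
  also have "\<dots> = (LINT t|lborel. f t * cnj (g t))"
    by (rule integral_lborel_translate[of "\<lambda>t. f t * cnj (g t)"]) measurable
  finally show "(LINT x|lborel. (case z of (x, \<omega>) \<Rightarrow> \<lambda>\<psi> t. exp (2 * of_real pi * \<i> * of_real (\<omega> \<bullet> t)) * \<psi> (t - x)) f x *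
      cnj ((case z of (x, \<omega>) \<Rightarrow> \<lambda>\<psi> t. exp (2 * of_real pi * \<i> * of_real (\<omega> \<bullet> t)) * \<psi> (t - x)) g x))
      = (LINT x|lborel. f x * cnj (g x))"
    by (simp add: case_prod_unfold)
qed

lemma tf_shift_zero [simp]: "tf_shift 0 x = x"
  by transfer (simp add: zero_prod_def)

lemma tf_shift_tf_shift:
  "tf_shift z (tf_shift w x) = exp (- 2 * of_real pi * \<i> * of_real (snd w \<bullet> fst z)) *\<^sub>C tf_shift (z + w) x"
proof transfer
  fix z w :: "'a \<times> 'a" and f :: "'a \<Rightarrow> complex"
  assume f: "l2rel f f"
  let ?U = "\<lambda>z (f :: 'a \<Rightarrow> complex) t. exp (2 * of_real pi * \<i> * of_real (snd z \<bullet> t)) * f (t - fst z)"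
  have "?U z (?U w f) = (\<lambda>t. exp (- 2 * of_real pi * \<i> * of_real (snd w \<bullet> fst z)) * ?U (z + w) f t)"
  proof
    fix t
    have "exp (2 * of_real pi * \<i> * of_real (snd z \<bullet> t)) * exp (2 * of_real pi * \<i> * of_real (snd w \<bullet> (t - fst z)))
        = exp (- 2 * of_real pi * \<i> * of_real (snd w \<bullet> fst z)) * (exp (2 * of_real pi * \<i> * of_real (snd (z + w) \<bullet> t)) :: complex)"
      unfolding exp_add[symmetric] by (rule arg_cong[of _ _ exp]) (simp add: inner_diff_right inner_add_left algebra_simps)
    then show "?U z (?U w f) t = exp (- 2 * of_real pi * \<i> * of_real (snd w \<bullet> fst z)) * ?U (z + w) f t"
      by (simp add: mult.assoc[symmetric] diff_diff_eq add.commute)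
  qed
  then show "l2rel ((case z of (x, \<omega>) \<Rightarrow> \<lambda>\<psi> t. exp (2 * of_real pi * \<i> * of_real (\<omega> \<bullet> t)) * \<psi> (t - x))
        ((case w of (x, \<omega>) \<Rightarrow> \<lambda>\<psi> t. exp (2 * of_real pi * \<i> * of_real (\<omega> \<bullet> t)) * \<psi> (t - x)) f))
      (\<lambda>x. exp (- 2 * of_real pi * \<i> * of_real (snd w \<bullet> fst z)) *
        (case z + w of (x, \<omega>) \<Rightarrow> \<lambda>\<psi> t. exp (2 * of_real pi * \<i> * of_real (\<omega> \<bullet> t)) * \<psi> (t - x)) f x)"
    using l2rel_tf_shift[OF l2rel_tf_shift[OF f], of z w] by (simp add: case_prod_unfold)
qed

lemma tf_shift_tf_shift_phase:
  obtains c where "cmod c = 1" and "\<And>x. tf_shift z (tf_shift w x) = c *\<^sub>C tf_shift (z + w) x"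
proof
  show "cmod (exp (- 2 * of_real pi * \<i> * of_real (snd w \<bullet> fst z))) = 1"
    by (simp add: norm_exp_eq_Re)
qed (rule tf_shift_tf_shift)

lemma surj_tf_shift: "surj (tf_shift z)"
proof -
  obtain c where "cmod c = 1" and c: "\<And>x. tf_shift z (tf_shift (- z) x) = c *\<^sub>C x"
    using tf_shift_tf_shift_phase[of z "- z"] by (metis add.right_inverse tf_shift_zero)
  then have "c \<noteq> 0" by auto
  then have "tf_shift z (tf_shift (- z) (inverse c *\<^sub>C x)) = x" for x
    by (simp add: c scaleC_scaleC)
  then show ?thesis by (rule surjI)
qed

lemma inj_tf_shift: "inj (tf_shift z)"
proof (rule injI)
  fix x y assume "tf_shift z x = tf_shift z y"
  then have "cinner x w = cinner y w" for w
    by (metis cinner_tf_shift)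
  then show "x = y" by (rule l2_eqI)
qed

text \<open>
  Time-frequency shifts preserve the inner product and are surjective, so the adjoint is the inverse.
  Linearity of a shift and of its adjoint then follow from the adjoint relation alone.
\<close>

lemma cinner_tf_shift_inv: "cinner (tf_shift z x) y = cinner x (inv (tf_shift z) y)"
  by (metis cinner_tf_shift surj_f_inv_f surj_tf_shift)

lemma adjoint_tf_shift: "adjoint_op (tf_shift z) = inv (tf_shift z)"
  unfolding adjoint_op_def
proof (rule the_equality)
  fix B assume "\<forall>x y. cinner (tf_shift z x) y = cinner x (B y)"
  then show "B = inv (tf_shift z)"
    by (intro ext l2_eqI_right) (simp add: cinner_tf_shift_inv)
qed (simp add: cinner_tf_shift_inv)

lemma cinner_tf_shift_adjoint:
  "cinner (tf_shift z x) y = cinner x (adjoint_op (tf_shift z) y)"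
  "cinner x (tf_shift z y) = cinner (adjoint_op (tf_shift z) x) y"
  unfolding adjoint_tf_shift
  by (rule cinner_tf_shift_inv) (metis cinner_tf_shift_inv cinner_commute)

lemma bounded_clinear_tf_shift: "bounded_clinear (tf_shift z)"
proof -
  have "tf_shift z (x + y) = tf_shift z x + tf_shift z y" for x y
    by (rule l2_eqI) (simp add: cinner_add_left cinner_tf_shift_adjoint)
  moreover have scale: "tf_shift z (c *\<^sub>C x) = c *\<^sub>C tf_shift z x" for c x
    by (rule l2_eqI) (simp add: cinner_scaleC_left cinner_tf_shift_adjoint)
  moreover have "norm (tf_shift z x) = norm x" for x
    by (simp add: norm_l2_def inner_l2_def cinner_tf_shift)
  ultimately show ?thesis
    by (auto simp: bounded_clinear_def scaleR_l2_def intro!: bounded_linear_intro[where K = 1])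
qed

lemma norm_tf_shift: "norm (tf_shift z x) = norm x"
  by (simp add: norm_l2_def inner_l2_def cinner_tf_shift)

lemma tf_shift_adjoint: "tf_shift z (adjoint_op (tf_shift z) x) = x"
  by (simp add: adjoint_tf_shift surj_f_inv_f surj_tf_shift)

lemma norm_adjoint_tf_shift: "norm (adjoint_op (tf_shift z) x) = norm x"
  by (metis norm_tf_shift tf_shift_adjoint)

text \<open>
  The shifts form a group only up to phases. The phases are kept existentially quantified because they
  cancel in every sesquilinear expression below (lemma \<open>cinner_phase_invariant\<close>).
\<close>

lemma adjoint_tf_shift_phase:
  obtains c where "cmod c = 1" and "\<And>x. adjoint_op (tf_shift z) x = c *\<^sub>C tf_shift (- z) x"
proof -
  obtain c where nc: "cmod c = 1" and c: "\<And>x. tf_shift z (tf_shift (- z) x) = c *\<^sub>C x"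
    using tf_shift_tf_shift_phase[of z "- z"] by (metis add.right_inverse tf_shift_zero)
  have "c \<noteq> 0" using nc by auto
  have "tf_shift z (inverse c *\<^sub>C tf_shift (- z) x) = x" for x
    using \<open>c \<noteq> 0\<close> bounded_clinear_tf_shift[of z] by (simp add: bounded_clinear_def c scaleC_scaleC)
  then have "adjoint_op (tf_shift z) x = inverse c *\<^sub>C tf_shift (- z) x" for x
    unfolding adjoint_tf_shift by (metis inj_tf_shift inv_f_f)
  then show ?thesis
    using nc by (intro that[of "inverse c"]) (simp_all add: norm_inverse)
qed

lemma bounded_clinear_adjoint_tf_shift: "bounded_clinear (adjoint_op (tf_shift z))"
proof -
  let ?U = "adjoint_op (tf_shift z)"
  have "?U (x + y) = ?U x + ?U y" for x y
    by (rule l2_eqI) (simp add: cinner_add_left cinner_tf_shift_adjoint(2)[symmetric])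
  moreover have "?U (c *\<^sub>C x) = c *\<^sub>C ?U x" for c x
    by (rule l2_eqI) (simp add: cinner_scaleC_left cinner_tf_shift_adjoint(2)[symmetric])
  ultimately show ?thesis
    by (auto simp: bounded_clinear_def scaleR_l2_def norm_adjoint_tf_shift intro!: bounded_linear_intro[where K = 1])
qed

lemma cinner_phase_invariant:
  assumes "bounded_clinear S" "cmod c = 1"
  shows "cinner (S (c *\<^sub>C x)) (c *\<^sub>C y) = cinner (S x) y"
proof -
  have "cnj c * c = 1"
    using assms(2) by (simp add: complex_norm_square[symmetric] mult.commute)
  then show ?thesis
    using assms(1)
    by (simp add: bounded_clinear_def cinner_scaleC_left cinner_scaleC_right mult.assoc[symmetric]
        mult.commute[of c])
qed

section \<open>Shifted and reflected operators\<close>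

lemma bounded_clinear_comp: "bounded_clinear A \<Longrightarrow> bounded_clinear B \<Longrightarrow> bounded_clinear (A \<circ> B)"
  by (simp add: bounded_clinear_def bounded_linear_compose o_def)

lemma bounded_clinear_op_shift: "bounded_clinear S \<Longrightarrow> bounded_clinear (op_shift z S)"
  unfolding op_shift_def
  by (intro bounded_clinear_comp bounded_clinear_tf_shift bounded_clinear_adjoint_tf_shift)

lemma cinner_op_shift:
  "cinner (op_shift z S x) y = cinner (S (adjoint_op (tf_shift z) x)) (adjoint_op (tf_shift z) y)"
  by (simp add: op_shift_def cinner_tf_shift_adjoint)

lemma op_shift_rank_one: "op_shift z (x \<otimes>\<^sub>o y) = tf_shift z x \<otimes>\<^sub>o tf_shift z y"
  using bounded_clinear_tf_shift[of z]
  by (auto simp: op_shift_def rank_one_def cinner_tf_shift_adjoint bounded_clinear_def)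

lemma nuclear_series_op_shift:
  assumes "nuclear_series s e f T"
  shows "nuclear_series s (\<lambda>n. tf_shift z (e n)) (\<lambda>n. tf_shift z (f n)) (op_shift z T)"
proof -
  have bl: "bounded_linear (tf_shift z)"
    using bounded_clinear_tf_shift by (rule bounded_clinear_bounded_linear)
  have "(\<lambda>n. s n *\<^sub>R (tf_shift z (e n) \<otimes>\<^sub>o tf_shift z (f n)) x) sums op_shift z T x" for x
  proof -
    have "(\<lambda>n. tf_shift z (s n *\<^sub>R (e n \<otimes>\<^sub>o f n) (adjoint_op (tf_shift z) x)))
        sums tf_shift z (T (adjoint_op (tf_shift z) x))"
      using assms by (intro bounded_linear.sums[OF bl]) (simp add: nuclear_series_def)
    moreover have "tf_shift z (s n *\<^sub>R (e n \<otimes>\<^sub>o f n) (adjoint_op (tf_shift z) x))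
        = s n *\<^sub>R (tf_shift z (e n) \<otimes>\<^sub>o tf_shift z (f n)) x" for n
      by (simp add: op_shift_rank_one[symmetric] op_shift_def linear_scale[OF bounded_linear.linear[OF bl]])
    ultimately show ?thesis by (simp add: op_shift_def)
  qed
  then show ?thesis
    using assms by (simp add: nuclear_series_def norm_tf_shift)
qed

text \<open>
  The covariance behind the convolution formula: up to a phase, \<open>\<pi>(z - w) = \<pi>(w)\<^sup>* \<pi>(z)\<close>, so the shift by \<open>w\<close>
  can be moved from the vectors to the operator.
\<close>

lemma cinner_op_shift_diff:
  assumes S: "bounded_clinear S"
  shows "cinner (S (tf_shift (z - w) x)) (tf_shift (z - w) y)
    = cinner (op_shift w S (tf_shift z x)) (tf_shift z y)"
proof -
  obtain c where c: "cmod c = 1" "\<And>x. adjoint_op (tf_shift w) x = c *\<^sub>C tf_shift (- w) x"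
    using adjoint_tf_shift_phase by metis
  obtain d where d: "cmod d = 1" "\<And>x. tf_shift (- w) (tf_shift z x) = d *\<^sub>C tf_shift (- w + z) x"
    using tf_shift_tf_shift_phase by metis
  show ?thesis
    using c d by (simp add: cinner_op_shift scaleC_scaleC cinner_phase_invariant[OF S] norm_mult)
qed

lemma parity_parity [simp]: "parity (parity x) = x"
  by transfer simp

lemma parity_tf_shift_parity: "parity (tf_shift z (parity x)) = tf_shift (- z) x"
proof transfer
  fix z :: "'a \<times> 'a" and f :: "'a \<Rightarrow> complex"
  assume "l2rel f f"
  from l2rel_tf_shift[OF this, of "- z"]
  show "l2rel (\<lambda>x. (case z of (x, \<omega>) \<Rightarrow> \<lambda>\<psi> t. exp (2 * of_real pi * \<i> * of_real (\<omega> \<bullet> t)) * \<psi> (t - x)) (\<lambda>x. f (- x)) (- x))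
     ((case - z of (x, \<omega>) \<Rightarrow> \<lambda>\<psi> t. exp (2 * of_real pi * \<i> * of_real (\<omega> \<bullet> t)) * \<psi> (t - x)) f)"
    by (simp add: case_prod_unfold add.commute)
qed

lemma cinner_parity: "cinner (parity x) y = cinner x (parity y)"
proof transfer
  fix f g :: "'a \<Rightarrow> complex"
  assume "l2rel f f" "l2rel g g"
  then have [measurable]: "f \<in> borel_measurable borel" "g \<in> borel_measurable borel"
    by (auto simp: l2rel_def dest: sq_integrable_measurable)
  show "(LINT x|lborel. f (- x) * cnj (g x)) = (LINT x|lborel. f x * cnj (g (- x)))"
    using integral_lborel_reflect[of "\<lambda>t. f t * cnj (g (- t))"] by simp
qed

lemma bounded_clinear_parity: "bounded_clinear parity"
proof -
  have "parity (x + y) = parity x + parity y" for x y :: "'a l2"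
    by (rule l2_eqI) (simp add: cinner_add_left cinner_parity)
  moreover have "parity (c *\<^sub>C x) = c *\<^sub>C parity x" for c and x :: "'a l2"
    by (rule l2_eqI) (simp add: cinner_scaleC_left cinner_parity)
  moreover have "norm (parity x) = norm x" for x :: "'a l2"
    by (simp add: norm_l2_def inner_l2_def cinner_parity)
  ultimately show ?thesis
    by (auto simp: bounded_clinear_def scaleR_l2_def intro!: bounded_linear_intro[where K = 1])
qed

lemma op_check_op_check: "op_check (op_check S) = S"
  by (simp add: op_check_def fun_eq_iff)

lemma op_check_rank_one:
  fixes x y :: "'a::euclidean_space l2"
  shows "op_check (x \<otimes>\<^sub>o y) = parity x \<otimes>\<^sub>o parity y"
  using bounded_clinear_parity[where 'a = 'a] by (simp add: op_check_def rank_one_def cinner_parity bounded_clinear_def fun_eq_iff)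

lemma cohen_Q_eq:
  assumes S: "bounded_clinear S"
  shows "cohen_Q S x z = cinner (op_shift z S x) x"
proof -
  have "cohen_Q S x z = trace_op (op_check S \<circ> (tf_shift z (parity x) \<otimes>\<^sub>o tf_shift z (parity x)))"
    by (simp add: cohen_Q_def op_conv_def op_check_rank_one op_shift_rank_one)
  also have "\<dots> = cinner (op_check S (tf_shift z (parity x))) (tf_shift z (parity x))"
    unfolding op_check_def
    by (intro trace_op_comp_rank_one bounded_clinear_comp bounded_clinear_parity S)
  also have "\<dots> = cinner (S (tf_shift (- z) x)) (tf_shift (- z) x)"
    by (simp add: op_check_def cinner_parity parity_tf_shift_parity)
  also have "\<dots> = cinner (op_shift z S x) x"
    using cinner_op_shift_diff[OF S, of 0 z x x] by simp
  finally show ?thesis .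
qed

lemma op_tilde_diff:
  assumes S: "bounded_clinear S" and ser: "nuclear_series s e f S"
  shows "op_tilde S (z - w)
    = (\<Sum>n. of_real (s n) * cinner (op_shift w S (tf_shift z (e n))) (tf_shift z (f n)))"
  unfolding op_tilde_def op_conv_def op_check_op_check
    trace_op_comp_nuclear_series[OF S nuclear_series_op_shift[OF ser]] cinner_op_shift_diff[OF S] ..

section \<open>Pairing an operator with a nuclear series along its eigenfunctions\<close>

text \<open>
  Both sides are \<open>tr(A T)\<close>. An eigensystem is complete only up to the kernel of \<open>A\<close>, which suffices for
  \<open>A x = \<Sum>\<^sub>k \<lambda>\<^sub>k \<langle>x, h\<^sub>k\<rangle> h\<^sub>k\<close>: the projection onto the span of the eigenfunctions loses only a vector of the
  kernel. The eigenvalues are bounded by the operator norm, so Bessel's inequality dominates the double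
  series by \<open>\<Sum>\<^sub>n s\<^sub>n \<parallel>A\<parallel>\<close>.
\<close>

lemma sums_eigenvalues_nuclear_series:
  assumes A: "bounded_clinear A" and eig: "eigensystem A lam h" and T: "nuclear_series s e f T"
  shows "(\<lambda>k. of_real (lam k) * cinner (T (h k)) (h k)) sums (\<Sum>n. of_real (s n) * cinner (A (e n)) (f n))"
proof (rule has_sum_imp_sums, rule has_sum_swap_sums)
  have on: "orthonormal_on UNIV h" and Ah: "\<And>k. A (h k) = lam k *\<^sub>R h k"
    and ker: "\<And>x. (\<And>k. cinner x (h k) = 0) \<Longrightarrow> A x = 0"
    using eig by (auto simp: eigensystem_def orthonormal_seq_iff)
  have bA: "bounded_linear A" using A by (rule bounded_clinear_bounded_linear)
  have lam_le: "\<bar>lam k\<bar> \<le> onorm A" for k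
    using onorm[OF bA, of "h k"] orthonormal_on_norm[OF on, of k] by (simp add: Ah)
  let ?g = "\<lambda>n k. of_real (s n) * (of_real (lam k) * (cinner (e n) (h k) * cinner (h k) (f n)))"
  have sn: "0 \<le> s n" and en: "norm (e n) \<le> 1" and fn: "norm (f n) \<le> 1" for n
    using T by (auto simp: nuclear_series_def)
  show "(\<Sum>k\<in>F. cmod (?g n k)) \<le> s n * onorm A" if "finite F" "F \<subseteq> UNIV" for n F
  proof -
    have "(\<Sum>k\<in>F. cmod (?g n k))
        = s n * (\<Sum>k\<in>F. \<bar>lam k\<bar> * (cmod (cinner (e n) (h k)) * cmod (cinner (f n) (h k))))"
      using sn by (simp add: norm_mult sum_distrib_left cinner_commute[of _ "f n"])
    also have "\<dots> \<le> s n * (\<Sum>k\<in>F. onorm A * (cmod (cinner (e n) (h k)) * cmod (cinner (f n) (h k))))"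
      by (intro mult_left_mono sum_mono mult_right_mono sn lam_le) auto
    also have "\<dots> = s n * (onorm A * (\<Sum>k\<in>F. cmod (cinner (e n) (h k)) * cmod (cinner (f n) (h k))))"
      by (simp add: sum_distrib_left)
    also have "\<dots> \<le> s n * (onorm A * (norm (e n) * norm (f n)))"
      by (intro mult_left_mono sn onorm_pos_le[OF bA] Bessel_product_finite[OF on that])
    also have "\<dots> \<le> s n * (onorm A * (1 * 1))"
      using en fn by (intro mult_left_mono mult_mono sn onorm_pos_le[OF bA]) auto
    finally show ?thesis by simp
  qed
  show "summable (\<lambda>n. s n * onorm A)"
    using T by (intro summable_mult2) (simp add: nuclear_series_def)
  show "((\<lambda>k. ?g n k) has_sum of_real (s n) * cinner (A (e n)) (f n)) UNIV" for n
  proof -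
    obtain p where p: "((\<lambda>k. cinner (e n) (h k) *\<^sub>C h k) has_sum p) UNIV"
      and orth: "\<And>k. cinner (e n - p) (h k) = 0"
      using orthonormal_projection[OF on] by (metis UNIV_I)
    have "A (e n - p) = 0" using orth by (rule ker)
    then have "A (e n) = A p" by (simp add: linear_diff[OF bounded_linear.linear[OF bA]])
    moreover have "((\<lambda>k. cinner (A (cinner (e n) (h k) *\<^sub>C h k)) (f n)) has_sum cinner (A p) (f n)) UNIV"
      by (intro has_sum_cinner_left has_sum_bounded_linear[OF bA] p)
    moreover have "A (c *\<^sub>C h k) = (of_real (lam k) * c) *\<^sub>C h k" for c k
      using A by (simp add: bounded_clinear_def Ah scaleC_scaleR scaleR_scaleC)
    ultimately have "((\<lambda>k. of_real (lam k) * (cinner (e n) (h k) * cinner (h k) (f n)))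
        has_sum cinner (A (e n)) (f n)) UNIV"
      by (simp add: cinner_scaleC_left mult.assoc)
    then show ?thesis by (rule has_sum_cmult_right)
  qed
  show "(\<lambda>n. ?g n k) sums (of_real (lam k) * cinner (T (h k)) (h k))" for k
    using sums_mult[OF nuclear_series_cinner_sums[OF T, of "h k" "h k"], of "of_real (lam k)"]
    by (simp add: mult_ac)
qed

section \<open>Weak integrals over phase space\<close>

text \<open>
  For representatives of the two vectors the inner product is a parameter integral with a jointly
  measurable integrand, and such integrals are measurable in the parameter.
\<close>

lemma borel_measurable_cinner_tf_shift:
  "(\<lambda>z. cinner x (tf_shift z y)) \<in> borel_measurable borel"
proof -
  obtain f where f: "sq_integrable f" "x = abs_l2 f" by (rule abs_l2_surj)
  obtain g where g: "sq_integrable g" "y = abs_l2 g" by (rule abs_l2_surj)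
  have [measurable]: "f \<in> borel_measurable borel" "g \<in> borel_measurable borel"
    using f g by (auto dest: sq_integrable_measurable)
  have r: "l2rel f f" "l2rel g g" using f g by (auto simp: l2rel_def)
  have eq: "cinner x (tf_shift z y) = (LINT t|lborel. f t * cnj (exp (2 * of_real pi * \<i> * of_real (snd z \<bullet> t)) * g (t - fst z)))" for z
    using r l2rel_tf_shift[OF r(2), of z]
    by (simp add: f g tf_shift.abs_eq cinner.abs_eq case_prod_unfold)
  have exp_meas: "(\<lambda>p :: ('a \<times> 'a) \<times> 'a. exp (2 * of_real pi * \<i> * of_real (snd (fst p) \<bullet> snd p)) :: complex)
      \<in> borel_measurable borel"
    by (intro borel_measurable_continuous_onI continuous_intros)
  have f_meas: "(\<lambda>p :: ('a \<times> 'a) \<times> 'a. f (snd p)) \<in> borel_measurable borel"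
    by (rule measurable_compose[of snd borel borel f borel])
      (auto intro!: borel_measurable_continuous_onI continuous_intros)
  have g_meas: "(\<lambda>p :: ('a \<times> 'a) \<times> 'a. g (snd p - fst (fst p))) \<in> borel_measurable borel"
    by (rule measurable_compose[of "\<lambda>p. snd p - fst (fst p)" borel borel g borel])
      (auto intro!: borel_measurable_continuous_onI continuous_intros)
  have "(\<lambda>p :: ('a \<times> 'a) \<times> 'a. f (snd p) *
      cnj (exp (2 * of_real pi * \<i> * of_real (snd (fst p) \<bullet> snd p)) * g (snd p - fst (fst p))))
      \<in> borel_measurable borel"
    by (intro borel_measurable_times borel_measurable_cnj exp_meas f_meas g_meas)
  moreover have "sets ((borel :: ('a \<times> 'a) measure) \<Otimes>\<^sub>M (lborel :: 'a measure)) = sets borel"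
    unfolding borel_prod[symmetric] by (rule sets_pair_measure_cong) simp_all
  ultimately have "(\<lambda>(z, t). f t * cnj (exp (2 * of_real pi * \<i> * of_real (snd z \<bullet> t)) * g (t - fst z)))
      \<in> borel_measurable ((borel :: ('a \<times> 'a) measure) \<Otimes>\<^sub>M lborel)"
    unfolding case_prod_unfold by (subst measurable_cong_sets[OF _ refl])
  then show ?thesis
    unfolding eq by (rule lborel.borel_measurable_lebesgue_integral)
qed

lemma borel_measurable_cinner_op_shift:
  assumes "nuclear_series s e f T"
  shows "(\<lambda>w. cinner (op_shift w T x) y) \<in> borel_measurable borel"
proof -
  note [measurable] = borel_measurable_cinner_tf_shift
  have "(\<lambda>w. \<Sum>n. of_real (s n) * (cinner x (tf_shift w (f n)) * cnj (cinner y (tf_shift w (e n))))) \<in> borel_measurable borel"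
    by measurable
  also have "(\<lambda>w. \<Sum>n. of_real (s n) * (cinner x (tf_shift w (f n)) * cnj (cinner y (tf_shift w (e n)))))
      = (\<lambda>w. cinner (op_shift w T x) y)"
    using nuclear_series_cinner_sums[OF nuclear_series_op_shift[OF assms]]
    by (simp add: sums_iff cinner_commute[of _ y, symmetric])
  finally show ?thesis .
qed

lemma cmod_cinner_op_shift_le:
  assumes S: "bounded_clinear S"
  shows "cmod (cinner (op_shift w S x) y) \<le> onorm S * norm x * norm y"
proof -
  let ?u = "adjoint_op (tf_shift w)"
  have "cmod (cinner (op_shift w S x) y) \<le> norm (S (?u x)) * norm (?u y)"
    unfolding cinner_op_shift by (rule cmod_cinner_le)
  also have "\<dots> \<le> (onorm S * norm (?u x)) * norm (?u y)"
    using onorm[OF bounded_clinear_bounded_linear[OF S], of "?u x"] by (intro mult_right_mono) auto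
  finally show ?thesis by (simp add: norm_adjoint_tf_shift)
qed

text \<open>
  The weak integrals define a sesquilinear form bounded by \<open>\<parallel>S\<parallel>\<close> times the \<open>L\<^sup>1\<close> norm of \<open>g\<close>; the operator
  representing it is the unique one meeting the description of \<open>fun_op_conv\<close>.
\<close>

lemma fun_op_conv_weak_integral:
  assumes S: "bounded_clinear S" and ser: "nuclear_series s e f S" and g: "integrable lborel g"
  shows "bounded_clinear (fun_op_conv g S)"
    and "cinner (fun_op_conv g S x) y = (LINT w|lborel. g w * cinner (op_shift w S x) y)"
    and "integrable lborel (\<lambda>w. g w * cinner (op_shift w S x) y)"
proof -
  note [measurable] = borel_measurable_cinner_op_shift[OF ser]
  have [measurable]: "g \<in> borel_measurable borel" using borel_measurable_integrable[OF g] by simp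
  have le: "norm (g w * cinner (op_shift w S x) y) \<le> (onorm S * norm x * norm y) * norm (g w)" for w x y
    using mult_left_mono[OF cmod_cinner_op_shift_le[OF S, of w x y], of "norm (g w)"]
    by (simp add: norm_mult mult.commute)
  have int: "integrable lborel (\<lambda>w. g w * cinner (op_shift w S x) y)" for x y
  proof (rule Bochner_Integration.integrable_bound)
    show "integrable lborel (\<lambda>w. (onorm S * norm x * norm y) * norm (g w))"
      using g by (intro integrable_mult_right integrable_norm)
    show "AE w in lborel. norm (g w * cinner (op_shift w S x) y)
        \<le> norm ((onorm S * norm x * norm y) * norm (g w))"
      using le by (intro AE_I2) (simp add: order_trans[OF _ abs_ge_self])
  qed measurable
  define \<Phi> where "\<Phi> x y = (LINT w|lborel. g w * cinner (op_shift w S x) y)" for x y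
  have lin: "op_shift w S (x + y) = op_shift w S x + op_shift w S y"
    "op_shift w S (c *\<^sub>C x) = c *\<^sub>C op_shift w S x" for w x y c
    using bounded_clinear_op_shift[OF S, of w]
    by (simp_all add: bounded_clinear_def linear_add bounded_linear.linear)
  have "cmod (\<Phi> x y) \<le> (onorm S * (LINT w|lborel. norm (g w))) * norm x * norm y" for x y
  proof -
    have "cmod (\<Phi> x y) \<le> (LINT w|lborel. norm (g w * cinner (op_shift w S x) y))"
      unfolding \<Phi>_def by (rule integral_norm_bound)
    also have "\<dots> \<le> (LINT w|lborel. (onorm S * norm x * norm y) * norm (g w))"
      by (rule integral_mono) (use g int le in auto)
    also have "\<dots> = (onorm S * (LINT w|lborel. norm (g w))) * norm x * norm y"
      by (simp add: mult_ac)
    finally show ?thesis .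
  qed
  moreover have "0 \<le> onorm S * (LINT w|lborel. norm (g w))"
    by (intro mult_nonneg_nonneg onorm_pos_le bounded_clinear_bounded_linear[OF S]) simp
  ultimately have "\<exists>A. bounded_clinear A \<and> (\<forall>x y. cinner (A x) y = \<Phi> x y)"
    by (intro sesquilinear_representation)
      (auto simp: \<Phi>_def lin cinner_add_left cinner_add_right cinner_scaleC_left cinner_scaleC_right
        distrib_left int mult.left_commute[of "g _"])
  then have "\<exists>!A. bounded_clinear A \<and> (\<forall>x y. cinner (A x) y = \<Phi> x y)"
    by (metis (no_types, lifting) l2_eqI ext)
  from theI'[OF this]
  have "bounded_clinear (fun_op_conv g S) \<and> (\<forall>x y. cinner (fun_op_conv g S x) y = \<Phi> x y)"
    unfolding fun_op_conv_def \<Phi>_def .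
  then show "bounded_clinear (fun_op_conv g S)"
    and "cinner (fun_op_conv g S x) y = (LINT w|lborel. g w * cinner (op_shift w S x) y)"
    by (simp_all add: \<Phi>_def)
  show "integrable lborel (\<lambda>w. g w * cinner (op_shift w S x) y)"
    by (rule int)
qed

text \<open>
  Each term of the series for \<open>op_tilde S (z - w)\<close> is a matrix coefficient of \<open>\<alpha>\<^sub>w(S)\<close>, which the weak integral
  turns into a matrix coefficient of \<open>fun_op_conv g S\<close>. Dominated convergence with the bound
  \<open>s\<^sub>n \<bar>g(w)\<bar> \<parallel>S\<parallel>\<close> allows integration term by term.
\<close>

lemma fun_conv_op_tilde:
  assumes S: "bounded_clinear S" and ser: "nuclear_series s e f S" and g: "integrable lborel g"
  shows "fun_conv g (op_tilde S) z
    = (\<Sum>n. of_real (s n) * cinner (fun_op_conv g S (tf_shift z (e n))) (tf_shift z (f n)))"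
proof -
  have sn: "0 \<le> s n" and en: "norm (e n) \<le> 1" and fn: "norm (f n) \<le> 1" for n
    using ser by (auto simp: nuclear_series_def)
  have ss: "summable s" using ser by (simp add: nuclear_series_def)
  have bS: "bounded_linear S" using S by (rule bounded_clinear_bounded_linear)
  let ?G = "\<lambda>n w. of_real (s n) * (g w * cinner (op_shift w S (tf_shift z (e n))) (tf_shift z (f n)))"
  have int: "integrable lborel (?G n)" for n
    by (intro integrable_mult_right fun_op_conv_weak_integral(3)[OF S ser g])
  have term_le: "cmod (of_real (s n) * cinner (op_shift w S (tf_shift z (e n))) (tf_shift z (f n)))
      \<le> s n * onorm S" for n w
  proof -
    have "cmod (cinner (op_shift w S (tf_shift z (e n))) (tf_shift z (f n))) \<le> onorm S * norm (e n) * norm (f n)"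
      using cmod_cinner_op_shift_le[OF S, of w "tf_shift z (e n)" "tf_shift z (f n)"] by (simp add: norm_tf_shift)
    also have "\<dots> \<le> onorm S * 1 * 1"
      using en fn by (intro mult_mono onorm_pos_le[OF bS]) (auto simp: onorm_pos_le[OF bS])
    finally show ?thesis
      using sn by (simp add: norm_mult mult_left_mono)
  qed
  have bound: "cmod (?G n w) \<le> s n * (cmod (g w) * onorm S)" for n w
    using mult_left_mono[OF term_le[of n w], of "cmod (g w)"] by (simp add: norm_mult mult_ac)
  have "(\<lambda>n. LINT w|lborel. ?G n w) sums (LINT w|lborel. (\<Sum>n. ?G n w))"
  proof (rule sums_integral[OF int])
    show "AE w in lborel. summable (\<lambda>n. norm (?G n w))"
    proof (rule AE_I2)
      fix w
      show "summable (\<lambda>n. norm (?G n w))"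
        by (rule summable_comparison_test'[OF summable_mult2[OF ss, of "cmod (g w) * onorm S"], of 0])
          (use bound in simp)
    qed
    show "summable (\<lambda>n. LINT w|lborel. norm (?G n w))"
    proof (rule summable_comparison_test'[OF summable_mult2[OF ss, of "LINT w|lborel. cmod (g w) * onorm S"], of 0])
      fix n
      have "(LINT w|lborel. norm (?G n w)) \<le> (LINT w|lborel. s n * (cmod (g w) * onorm S))"
        by (intro integral_mono bound integrable_norm[OF int] integrable_norm[OF g]
            integrable_mult_right integrable_mult_left)
      then show "norm (LINT w|lborel. norm (?G n w)) \<le> s n * (LINT w|lborel. cmod (g w) * onorm S)"
        by simp
    qed
  qed
  moreover have "(\<Sum>n. ?G n w) = g w * op_tilde S (z - w)" for w
  proof -
    have "summable (\<lambda>n. of_real (s n) * cinner (op_shift w S (tf_shift z (e n))) (tf_shift z (f n)))"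
      by (rule summable_comparison_test'[OF summable_mult2[OF ss, of "onorm S"], of 0]) (rule term_le)
    from suminf_mult[OF this, of "g w"] show ?thesis
      by (simp add: op_tilde_diff[OF S ser] mult.left_commute[of "g w"])
  qed
  moreover have "(LINT w|lborel. ?G n w)
      = of_real (s n) * cinner (fun_op_conv g S (tf_shift z (e n))) (tf_shift z (f n))" for n
    by (simp add: fun_op_conv_weak_integral(2)[OF S ser g])
  ultimately have "(\<lambda>n. of_real (s n) * cinner (fun_op_conv g S (tf_shift z (e n))) (tf_shift z (f n)))
      sums fun_conv g (op_tilde S) z"
    by (simp only: fun_conv_def)
  then show ?thesis by (rule sums_unique)
qed

section \<open>The spectral formula\<close>

theorem proposition3p2:
  fixes S :: "(real ^ 'n) l2 \<Rightarrow> (real ^ 'n) l2"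
    and \<Omega> :: "((real ^ 'n) \<times> (real ^ 'n)) set"
    and lam :: "nat \<Rightarrow> real"
    and h :: "nat \<Rightarrow> (real ^ 'n) l2"
    and z :: "(real ^ 'n) \<times> (real ^ 'n)"
  assumes "density_operator S"
    and "compact \<Omega>"
    and "eigensystem (fun_op_conv (indicator \<Omega>) S) lam h"
  shows "(\<lambda>k. complex_of_real (lam k) * cohen_Q S (h k) z)
           sums fun_conv (indicator \<Omega>) (op_tilde S) z"
proof -
  have "trace_class S" using assms(1) by (simp add: density_operator_def)
  then have S: "bounded_clinear S" by (simp add: trace_class_def)
  obtain s e f where ser: "nuclear_series s e f S"
    using \<open>trace_class S\<close> by (rule trace_class_nuclear_series)
  have g: "integrable lborel (indicator \<Omega> :: _ \<Rightarrow> complex)"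
  proof -
    have "integrable lborel (\<lambda>w. complex_of_real (indicator \<Omega> w))"
      using assms(2) by (intro integrable_of_real integrable_real_indicator)
        (use emeasure_compact_finite[OF assms(2)] in \<open>auto simp: borel_compact\<close>)
    then show ?thesis by (simp add: of_real_indicator)
  qed
  show ?thesis
    using sums_eigenvalues_nuclear_series[OF fun_op_conv_weak_integral(1)[OF S ser g] assms(3)
        nuclear_series_op_shift[OF ser, of z]]
    by (simp add: fun_conv_op_tilde[OF S ser g] cohen_Q_eq[OF S])
qed

end
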